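(* Let $p,q\ge1$, $d_h,\rho_h>0$ ($1\le h\le q$), $\xi_1,\dots,\xi_p\in\mathbb R$ with $\xi_i+\rho_h>0$ for all $i,h$. Let $\boldsymbol m\in\mathbb N_0^q$ be near the diagonal ($|m_i-m_j|\le1$ for all $i,j$) with $N=|\boldsymbol m|\ge1$. Suppose that the rates $\rho_h$ with $m_h>0$ are pairwise distinct and that the column nodes $\xi_i$ with positive column index $n_i$ are pairwise distinct. Let $\mathscr S_{\mathrm A}^{\mathrm{LII}}$ be the solution space of the homogeneous $A$-problem for a column index $\boldsymbol n$ with $|\boldsymbol n|=N+1$, and $\mathscr S_{\mathrm B}^{\mathrm{LII}}$ that of the homogeneous $B$-problem for a column index $\boldsymbol n$ with $|\boldsymbol n|=N-1$ (see context). Then $$\dim\mathscr S_{\mathrm A}^{\mathrm{LII}}=1,\qquad\dim\mathscr S_{\mathrm B}^{\mathrm{LII}}=1.$$ The $A$-problem is strongly normal. The $B$-problem is weakly normal, and its nonzero vectors represent nonzero forms. In particular, the function $\mathcal B^{\mathrm{LII}}_{\boldsymbol n,\boldsymbol m}=-\prod_{i=1}^p(\xi_i-\mathrm d/\mathrm dy)^{n_i}S_{\boldsymbol m}$ (with $|\boldsymbol n|=N-1$) has a unique decomposition $\sum_jB_j(y)F_j(y)$ with polynomials $B_j$, $\deg B_j<m_j$ (so $B_j=0$ if $m_j=0$). If all the rates $\rho_1,\dots,\rho_q$ are distinct, the functions $F_1,\dots,F_q$ are linearly independent over the polynomial ring.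
   Context: Gamma kernels $g_{\rho,d}(y)=\frac{y^{d-1}\mathrm e^{-\rho y}}{\Gamma(d)}\mathbf 1_{(0,\infty)}(y)$; $(f*_+g)(y)=\int_0^yf(u)g(y-u)\,\mathrm du$; $F_j=g_{\rho_1,d_1+\delta_{1,j}}*_+\cdots*_+g_{\rho_q,d_q+\delta_{q,j}}$ ($1\le j\le q$); $S_{\boldsymbol m}=g_{\rho_1,d_1+m_1}*_+\cdots*_+g_{\rho_q,d_q+m_q}$. $A$-problem ($|\boldsymbol n|=|\boldsymbol m|+1$): polynomial vectors $(A_1,\dots,A_p)$ with $\deg A_i\le n_i-1$ ($A_i=0$ if $n_i=0$) and $\int_0^\infty y^kF_j(y)\sum_iA_i(y)\mathrm e^{-\xi_iy}\,\mathrm dy=0$ for $1\le j\le q$, $0\le k<m_j$. $B$-problem ($|\boldsymbol m|=|\boldsymbol n|+1$): polynomial vectors $(B_1,\dots,B_q)$ with $\deg B_j\le m_j-1$ and $\int_0^\infty y^k\mathrm e^{-\xi_iy}\sum_jB_j(y)F_j(y)\,\mathrm dy=0$ for $1\le i\le p$, $0\le k<n_i$. The form represented by a vector is $\sum_iA_i\mathrm e^{-\xi_iy}$, respectively $\sum_jB_jF_j$. A problem is weakly normal if the space of polynomial component vectors solving it is one-dimensional; it is strongly normal if in addition every component (of a nonzero solution) with positive index attains its prescribed maximal degree. *)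

theory Defs
  imports "HOL-Analysis.Analysis" "HOL-Computational_Algebra.Polynomial"
    "HOL-Library.Function_Algebras"
begin

section \<open>Gamma kernels and half-line convolution\<close>

definition gamma_kernel :: "real \<Rightarrow> real \<Rightarrow> real \<Rightarrow> real" where
  "gamma_kernel \<rho> d y =
     (y powr (d - 1) * exp (- \<rho> * y) / Gamma d) * indicator {0<..} y"

definition half_conv :: "(real \<Rightarrow> real) \<Rightarrow> (real \<Rightarrow> real) \<Rightarrow> real \<Rightarrow> real" where
  "half_conv f g y = (LBINT u:{0..y}. f u * g (y - u))"

text \<open>The convolution of \<open>f 1, \<dots>, f q\<close>, bracketed to the left, for \<open>q \<ge> 1\<close>.\<close>

definition iter_conv :: "nat \<Rightarrow> (nat \<Rightarrow> real \<Rightarrow> real) \<Rightarrow> real \<Rightarrow> real" where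
  "iter_conv q f = foldl half_conv (f 1) (map f [2..<Suc q])"

definition F_fun :: "nat \<Rightarrow> (nat \<Rightarrow> real) \<Rightarrow> (nat \<Rightarrow> real) \<Rightarrow> nat \<Rightarrow> real \<Rightarrow> real" where
  "F_fun q \<rho> d j = iter_conv q (\<lambda>h. gamma_kernel (\<rho> h) (d h + (if h = j then 1 else 0)))"

definition S_fun :: "nat \<Rightarrow> (nat \<Rightarrow> real) \<Rightarrow> (nat \<Rightarrow> real) \<Rightarrow> (nat \<Rightarrow> nat) \<Rightarrow> real \<Rightarrow> real" where
  "S_fun q \<rho> d m = iter_conv q (\<lambda>h. gamma_kernel (\<rho> h) (d h + real (m h)))"

definition shift_op :: "real \<Rightarrow> (real \<Rightarrow> real) \<Rightarrow> real \<Rightarrow> real" where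
  "shift_op c f = (\<lambda>y. c * f y - deriv f y)"

text \<open>Only the values at \<open>y > 0\<close> are meaningful: \<open>S_fun\<close> is smooth there, but in general
  not differentiable at \<open>0\<close>.\<close>

definition B_LII :: "nat \<Rightarrow> nat \<Rightarrow> (nat \<Rightarrow> real) \<Rightarrow> (nat \<Rightarrow> real) \<Rightarrow> (nat \<Rightarrow> real)
    \<Rightarrow> (nat \<Rightarrow> nat) \<Rightarrow> (nat \<Rightarrow> nat) \<Rightarrow> real \<Rightarrow> real" where
  "B_LII p q \<rho> d \<xi> n m =
     (\<lambda>y. - foldr (\<lambda>i. shift_op (\<xi> i) ^^ n i) [1..<Suc p] (S_fun q \<rho> d m) y)"

section \<open>Polynomial vectors\<close>

text \<open>A vector with components indexed by \<open>{1..r}\<close> is a function on \<open>nat\<close> vanishing off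
  \<open>{1..r}\<close>.  Since \<open>degree 0 = 0\<close>, the bound \<open>deg \<le> n i - 1\<close>, with \<open>0\<close> as the only
  polynomial allowed for \<open>n i = 0\<close>, reads \<open>A i = 0 \<or> degree (A i) < n i\<close>.\<close>

definition poly_vectors :: "nat \<Rightarrow> (nat \<Rightarrow> nat) \<Rightarrow> (nat \<Rightarrow> real poly) set" where
  "poly_vectors r n = {A. (\<forall>i. i \<notin> {1..r} \<longrightarrow> A i = 0) \<and>
                          (\<forall>i\<in>{1..r}. A i = 0 \<or> degree (A i) < n i)}"

definition scale_vec :: "real \<Rightarrow> (nat \<Rightarrow> real poly) \<Rightarrow> (nat \<Rightarrow> real poly)" where
  "scale_vec c A = (\<lambda>i. smult c (A i))"

lemma vector_space_scale_vec: "vector_space scale_vec"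
  by unfold_locales
    (auto simp: scale_vec_def fun_eq_iff smult_add_right smult_add_left)

definition A_form :: "nat \<Rightarrow> (nat \<Rightarrow> real) \<Rightarrow> (nat \<Rightarrow> real poly) \<Rightarrow> real \<Rightarrow> real" where
  "A_form p \<xi> A y = (\<Sum>i=1..p. poly (A i) y * exp (- \<xi> i * y))"

definition B_form :: "nat \<Rightarrow> (nat \<Rightarrow> real) \<Rightarrow> (nat \<Rightarrow> real) \<Rightarrow> (nat \<Rightarrow> real poly) \<Rightarrow> real \<Rightarrow> real" where
  "B_form q \<rho> d B y = (\<Sum>j=1..q. poly (B j) y * F_fun q \<rho> d j y)"

section \<open>The homogeneous problems\<close>

text \<open>Integrability is required explicitly because the Bochner integral of a
  non-integrable function is \<open>0\<close> by convention.\<close>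

definition vanishing_integral :: "(real \<Rightarrow> real) \<Rightarrow> bool" where
  "vanishing_integral f \<longleftrightarrow>
     set_integrable lborel {0<..} f \<and> (LBINT y:{0<..}. f y) = 0"

definition A_solutions :: "nat \<Rightarrow> nat \<Rightarrow> (nat \<Rightarrow> real) \<Rightarrow> (nat \<Rightarrow> real) \<Rightarrow> (nat \<Rightarrow> real)
    \<Rightarrow> (nat \<Rightarrow> nat) \<Rightarrow> (nat \<Rightarrow> nat) \<Rightarrow> (nat \<Rightarrow> real poly) set" where
  "A_solutions p q \<rho> d \<xi> n m =
     {A \<in> poly_vectors p n. \<forall>j\<in>{1..q}. \<forall>k<m j.
        vanishing_integral (\<lambda>y. y ^ k * F_fun q \<rho> d j y * A_form p \<xi> A y)}"

definition B_solutions :: "nat \<Rightarrow> nat \<Rightarrow> (nat \<Rightarrow> real) \<Rightarrow> (nat \<Rightarrow> real) \<Rightarrow> (nat \<Rightarrow> real)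
    \<Rightarrow> (nat \<Rightarrow> nat) \<Rightarrow> (nat \<Rightarrow> nat) \<Rightarrow> (nat \<Rightarrow> real poly) set" where
  "B_solutions p q \<rho> d \<xi> n m =
     {B \<in> poly_vectors q m. \<forall>i\<in>{1..p}. \<forall>k<n i.
        vanishing_integral (\<lambda>y. y ^ k * exp (- \<xi> i * y) * B_form q \<rho> d B y)}"

definition weakly_normal :: "(nat \<Rightarrow> real poly) set \<Rightarrow> bool" where
  "weakly_normal V \<longleftrightarrow>
     module.subspace scale_vec V \<and> vector_space.dim scale_vec V = 1"

text \<open>For \<open>n i = 1\<close> attaining the maximal degree \<open>0\<close> means being a nonzero constant, whence
  the explicit \<open>A i \<noteq> 0\<close>.\<close>

definition strongly_normal :: "nat \<Rightarrow> (nat \<Rightarrow> nat) \<Rightarrow> (nat \<Rightarrow> real poly) set \<Rightarrow> bool" where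
  "strongly_normal r n V \<longleftrightarrow> weakly_normal V \<and>
     (\<forall>A\<in>V. A \<noteq> 0 \<longrightarrow>
        (\<forall>i\<in>{1..r}. n i > 0 \<longrightarrow> A i \<noteq> 0 \<and> degree (A i) = n i - 1))"

definition lin_indep_over_polys :: "nat \<Rightarrow> (nat \<Rightarrow> real \<Rightarrow> real) \<Rightarrow> bool" where
  "lin_indep_over_polys q F \<longleftrightarrow>
     (\<forall>P :: nat \<Rightarrow> real poly. (\<forall>y>0. (\<Sum>j=1..q. poly (P j) y * F j y) = 0) \<longrightarrow>
        (\<forall>j\<in>{1..q}. P j = 0))"

end

theory Submission
  imports Defs
begin

text \<open>Let \<open>T l\<close> be the convolution of the kernels with exponents \<open>d h + l h\<close>. Its Laplace transform is
  \<open>\<Prod>h. (s + \<rho> h) powr - (d h + l h)\<close>, so relative to \<open>G m s = \<Prod>h. (s + \<rho> h) powr - (d h + m h)\<close> every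
  function \<open>y ^ k * F j y\<close> with \<open>k < m j\<close> has a transform \<open>P * G m\<close> with a polynomial \<open>P\<close> of degree
  less than \<open>N\<close>; near-diagonality is what keeps the poles inside \<open>G m\<close>. Comparing pole orders at
  \<open>- \<rho> j\<close> shows that these \<open>N\<close> polynomials are linearly independent, hence a basis of the
  polynomials of degree less than \<open>N\<close>. The B-problem then asks for \<open>P\<close> divisible by
  \<open>\<Prod>i. (s - \<xi> i) ^ n i\<close>, of degree \<open>N - 1\<close>, and the A-problem for a Hermite functional with
  \<open>N + 1\<close> nodes that kills all polynomials of degree less than \<open>N\<close>, i.e. a multiple of the
  divided difference. In the time domain \<open>P\<close> acts as the differential operator \<open>P(d/dy)\<close> on
  \<open>S m = T m\<close>, which gives the decomposition of \<open>B_LII\<close>.\<close>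

section \<open>Convolution of kernels with a power singularity at the origin\<close>

text \<open>The obstacle is the origin: for \<open>d h < 1\<close> the kernels are unbounded there,
  so convolutions cannot simply be differentiated under the integral sign. All kernels are kept in
  one class, a power of \<open>y\<close> times a continuous nonnegative factor, which is closed
  under convolution and open to Tonelli's theorem. Derivatives come from relations that have been
  integrated once, integration being convolution with the Heaviside function.

  The exponents \<open>d h\<close> need not be integers, so "pole order" at
  \<open>- \<rho> j\<close> refers to the order of vanishing of the polynomial left after division
  by \<open>G m\<close>. Multiplication by \<open>y\<close> raises one exponent \<open>l h\<close>
  by one, with positive weight \<open>d h + l h\<close>; only the term that always raises the index
  \<open>j\<close> is most singular at \<open>- \<rho> j\<close>, so nothing can cancel it. As all
  \<open>k\<close> increments may fall on the same \<open>h\<close>, every \<open>m h\<close> has to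
  leave room for them. Linear independence over the polynomials is the same argument with a large
  constant index in place of \<open>m\<close>.\<close>

lemma weighted_integrable:
  fixes W :: "real \<Rightarrow> real" and \<phi> :: "real \<times> real \<Rightarrow> real"
  assumes W: "integrable lborel W" and W0: "\<And>t. t \<notin> {0..1} \<Longrightarrow> W t = 0"
    and \<phi>: "continuous_on UNIV \<phi>"
  shows "integrable lborel (\<lambda>t. W t * \<phi> (y, t))"
    and "continuous_on UNIV (\<lambda>y. \<integral>t. W t * \<phi> (y, t) \<partial>lborel)"
proof -
  have [measurable]: "W \<in> borel_measurable borel"
    using W by (simp add: integrable_iff_bounded)
  have [measurable]: "\<phi> \<in> borel_measurable borel"
    using \<phi> by (rule borel_measurable_continuous_onI)
  have pair: "(\<lambda>t. \<phi> (y, t)) \<in> borel_measurable borel" for y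
    using \<phi> by (intro borel_measurable_continuous_onI continuous_intros
        continuous_on_compose2[OF \<phi>]) auto
  note [measurable] = pair
  \<comment> \<open>Compactness gives a multiple of \<open>W\<close> as a majorant that is uniform
    in \<open>y\<close>; it serves both integrability and dominated convergence.\<close>
  have bound: "\<exists>B. \<forall>y\<in>{-R..R}. \<forall>t\<in>{0..1}. \<bar>\<phi> (y, t)\<bar> \<le> B" for R
  proof -
    have "compact (\<phi> ` ({-R..R} \<times> {0..1}))"
      by (intro compact_continuous_image continuous_on_subset[OF \<phi>] compact_Times) auto
    then have "bounded (\<phi> ` ({-R..R} \<times> {0..1}))"
      by (rule compact_imp_bounded)
    then show ?thesis
      unfolding bounded_iff by fastforce
  qed
  have dom: "norm (W t * \<phi> (y, t)) \<le> \<bar>W t * B\<bar>"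
    if "\<forall>y\<in>{-R..R}. \<forall>t\<in>{0..1}. \<bar>\<phi> (y, t)\<bar> \<le> B" "y \<in> {-R..R}" for R B y t
  proof (cases "t \<in> {0..1}")
    case True
    then have "\<bar>\<phi> (y, t)\<bar> \<le> B" using that by blast
    then have "\<bar>\<phi> (y, t)\<bar> \<le> \<bar>B\<bar>" by linarith
    then show ?thesis by (auto simp: abs_mult intro: mult_left_mono)
  qed (simp add: W0)
  have WB: "integrable lborel (\<lambda>t. \<bar>W t * B\<bar>)" for B
    using W by auto
  show "integrable lborel (\<lambda>t. W t * \<phi> (y, t))"
  proof -
    obtain B where "\<forall>z\<in>{-\<bar>y\<bar>..\<bar>y\<bar>}. \<forall>t\<in>{0..1}. \<bar>\<phi> (z, t)\<bar> \<le> B"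
      using bound by blast
    moreover have "y \<in> {-\<bar>y\<bar>..\<bar>y\<bar>}" by (simp add: abs_le_D2 minus_le_iff)
    ultimately have "norm (W t * \<phi> (y, t)) \<le> norm \<bar>W t * B\<bar>" for t
      using dom[of "\<bar>y\<bar>" B y t] by simp
    then show ?thesis
      by (intro Bochner_Integration.integrable_bound[OF WB[of B]]) auto
  qed
  show "continuous_on UNIV (\<lambda>y. \<integral>t. W t * \<phi> (y, t) \<partial>lborel)"
    unfolding continuous_on_sequentially comp_def
  proof (intro ballI allI impI, elim conjE)
    fix Y :: "nat \<Rightarrow> real" and y assume Y: "Y \<longlonglongrightarrow> y"
    then obtain R where R: "\<And>n. \<bar>Y n\<bar> \<le> R"
      using convergent_imp_Bseq[of Y] unfolding convergent_def Bseq_def by auto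
    obtain B where B: "\<forall>z\<in>{-R..R}. \<forall>t\<in>{0..1}. \<bar>\<phi> (z, t)\<bar> \<le> B"
      using bound by blast
    have YR: "Y n \<in> {-R..R}" for n
      using R[of n] by auto
    show "(\<lambda>n. \<integral>t. W t * \<phi> (Y n, t) \<partial>lborel) \<longlonglongrightarrow> (\<integral>t. W t * \<phi> (y, t) \<partial>lborel)"
    proof (rule integral_dominated_convergence[OF _ _ WB[of B]])
      have "(\<lambda>n. \<phi> (Y n, t)) \<longlonglongrightarrow> \<phi> (y, t)" for t
        using Y \<phi>
        by (auto intro!: isCont_tendsto_compose[of _ \<phi>] tendsto_intros
            simp: continuous_on_eq_continuous_at)
      then show "AE t in lborel. (\<lambda>n. W t * \<phi> (Y n, t)) \<longlonglongrightarrow> W t * \<phi> (y, t)"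
        by (auto intro!: tendsto_intros)
      show "AE t in lborel. norm (W t * \<phi> (Y n, t)) \<le> \<bar>W t * B\<bar>" for n
        using dom[OF B YR] by auto
    qed auto
  qed
qed

text \<open>Continuity of \<open>H\<close> is required up to and across \<open>0\<close>, so that
  the only singularity is the integrable power; nonnegativity of \<open>H\<close> allows passing to
  integrals in \<open>ennreal\<close>.\<close>

definition power_kernel :: "real \<Rightarrow> (real \<Rightarrow> real) \<Rightarrow> bool" where
  "power_kernel a f \<longleftrightarrow> a > 0 \<and> (\<exists>H. continuous_on UNIV H \<and> (\<forall>y. H y \<ge> 0) \<and>
     f = (\<lambda>y. if y > 0 then y powr (a - 1) * H y else 0))"

lemma power_kernelE:
  assumes "power_kernel a f"
  obtains H where "a > 0" "continuous_on UNIV H" "\<And>y. H y \<ge> 0"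
    "f = (\<lambda>y. if y > 0 then y powr (a - 1) * H y else 0)"
  using assms unfolding power_kernel_def by auto

lemma power_kernel_nonneg: "power_kernel a f \<Longrightarrow> f y \<ge> 0"
  by (auto elim!: power_kernelE)

lemma power_kernel_nonpos: "power_kernel a f \<Longrightarrow> y \<le> 0 \<Longrightarrow> f y = 0"
  by (auto elim!: power_kernelE)

lemma power_kernel_continuous:
  assumes "power_kernel a f" shows "continuous_on {0<..} f"
proof -
  obtain H where H: "continuous_on UNIV H" "f = (\<lambda>y. if y > 0 then y powr (a - 1) * H y else 0)"
    using power_kernelE[OF assms] by blast
  have "continuous_on {0<..} (\<lambda>y. y powr (a - 1) * H y)"
    by (intro continuous_intros continuous_on_subset[OF H(1)]) auto
  then show ?thesis
    by (rule continuous_on_eq) (simp add: H)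
qed

lemma power_kernel_measurable:
  "power_kernel a f \<Longrightarrow> f \<in> borel_measurable borel"
proof (elim power_kernelE)
  fix H :: "real \<Rightarrow> real"
  assume "continuous_on UNIV H" "f = (\<lambda>y. if y > 0 then y powr (a - 1) * H y else 0)"
  moreover from this have [measurable]: "H \<in> borel_measurable borel"
    by (intro borel_measurable_continuous_onI)
  ultimately show ?thesis by simp
qed

lemma power_kernel_times:
  assumes "power_kernel a f" shows "power_kernel (a + 1) (\<lambda>y. y * f y)"
  using assms
proof (elim power_kernelE)
  fix H assume *: "a > 0" "continuous_on UNIV H" "\<And>y. H y \<ge> 0"
    "f = (\<lambda>y. if y > 0 then y powr (a - 1) * H y else 0)"
  then have "(\<lambda>y. y * f y) = (\<lambda>y. if y > 0 then y powr (a + 1 - 1) * H y else 0)"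
    by (auto simp: fun_eq_iff powr_diff field_simps)
  with * show ?thesis
    unfolding power_kernel_def by force
qed

lemma power_kernel_gamma:
  assumes "d > 0" shows "power_kernel d (gamma_kernel \<rho> d)"
  unfolding power_kernel_def
proof (intro conjI exI)
  show "gamma_kernel \<rho> d = (\<lambda>y. if y > 0 then y powr (d - 1) * (exp (- \<rho> * y) / Gamma d) else 0)"
    by (auto simp: gamma_kernel_def fun_eq_iff)
qed (use assms nonpos_Ints_nonpos[of d] in \<open>auto intro!: continuous_intros simp: Gamma_eq_zero_iff\<close>)

lemma conv_power_kernel:
  assumes f: "power_kernel a f" and g: "power_kernel b g"
  shows conv_integrable: "\<And>y. integrable lborel (\<lambda>u. f u * g (y - u))"
    and half_conv_eq: "\<And>y. half_conv f g y = (\<integral>u. f u * g (y - u) \<partial>lborel)"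
    and power_kernel_half_conv: "power_kernel (a + b) (half_conv f g)"
proof -
  obtain H where H: "a > 0" "continuous_on UNIV H" "\<And>y. H y \<ge> 0"
    "f = (\<lambda>y. if y > 0 then y powr (a - 1) * H y else 0)"
    using power_kernelE[OF f] by blast
  obtain K where K: "b > 0" "continuous_on UNIV K" "\<And>y. K y \<ge> 0"
    "g = (\<lambda>y. if y > 0 then y powr (b - 1) * K y else 0)"
    using power_kernelE[OF g] by blast
  \<comment> \<open>The substitution \<open>u = y * t\<close> separates the endpoint singularities,
    collected in the Beta weight \<open>W\<close>, from a factor \<open>\<phi>\<close> that is
    jointly continuous in \<open>(y, t)\<close>.\<close>
  define W where "W t = indicator {0..1} t * (t powr (a - 1) * (1 - t) powr (b - 1))" for t :: real
  define \<phi> where "\<phi> z = H (fst z * snd z) * K (fst z * (1 - snd z))" for z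
  have W: "integrable lborel W" "\<And>t. t \<notin> {0..1} \<Longrightarrow> W t = 0"
    using integrable_Beta[OF H(1) K(1)] by (auto simp: set_integrable_def W_def[abs_def])
  have \<phi>: "continuous_on UNIV \<phi>"
    unfolding \<phi>_def
    by (intro continuous_intros continuous_on_compose2[OF H(2)] continuous_on_compose2[OF K(2)]) auto
  note WI = weighted_integrable[OF W \<phi>]
  \<comment> \<open>The kernels contribute \<open>y powr (a + b - 2)\<close>, and the Jacobian
    \<open>y\<close> supplies the missing power later. The form \<open>0 + y * t\<close> is that of
    the affine substitution rule.\<close>
  have scale: "f (0 + y * t) * g (y - (0 + y * t)) = y powr (a + b - 2) * (W t * \<phi> (y, t))"
    if y: "y > 0" for y t
  proof (cases "t > 0 \<and> t < 1")
    case True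
    then have "y - y * t = y * (1 - t)" "y * t > 0" "y * (1 - t) > 0"
      using y by (auto simp: algebra_simps)
    moreover have "y powr (a + b - 2) = y powr (a - 1) * y powr (b - 1)"
      by (simp flip: powr_add add: algebra_simps)
    ultimately show ?thesis
      using True y by (simp add: H(4) K(4) W_def \<phi>_def powr_mult)
  next
    case False
    then have "t \<le> 0 \<or> t \<ge> 1" by auto
    then have "y * t \<le> 0 \<or> y - y * t \<le> 0"
      using y by (auto simp: mult_le_0_iff)
    moreover have "W t = 0" using False by (auto simp: W_def indicator_def)
    ultimately show ?thesis by (auto simp: H(4) K(4))
  qed
  have zero: "f u * g (y - u) = 0" if "y \<le> 0" for y u
    using that by (auto simp: H(4) K(4))
  show int: "integrable lborel (\<lambda>u. f u * g (y - u))" for y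
  proof (cases "y > 0")
    case True
    have "integrable lborel (\<lambda>t. f (0 + y * t) * g (y - (0 + y * t)))"
      unfolding scale[OF True] using WI(1) by auto
    then show ?thesis
      using lborel_integrable_real_affine_iff[of y "\<lambda>u. f u * g (y - u)" 0] True by auto
  qed (simp add: zero)
  show conv: "half_conv f g y = (\<integral>u. f u * g (y - u) \<partial>lborel)" for y
    unfolding half_conv_def set_lebesgue_integral_def
    by (intro Bochner_Integration.integral_cong) (auto simp: H(4) K(4) indicator_def)
  have "half_conv f g y = y powr (a + b - 1) * (\<integral>t. W t * \<phi> (y, t) \<partial>lborel)" if y: "y > 0" for y
  proof -
    have "half_conv f g y = y * (\<integral>t. f (0 + y * t) * g (y - (0 + y * t)) \<partial>lborel)"
      unfolding conv using y by (subst lborel_integral_real_affine[of y _ 0]) auto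
    also have "\<dots> = (y * y powr (a + b - 2)) * (\<integral>t. W t * \<phi> (y, t) \<partial>lborel)"
      unfolding scale[OF y] by simp
    also have "y * y powr (a + b - 2) = y powr (a + b - 1)"
      using y by (simp add: powr_mult_base)
    finally show ?thesis .
  qed
  moreover have "half_conv f g y = 0" if "y \<le> 0" for y
    unfolding conv zero[OF that] by simp
  moreover have "(\<integral>t. W t * \<phi> (y, t) \<partial>lborel) \<ge> 0" for y
    by (intro Bochner_Integration.integral_nonneg) (auto simp: W_def \<phi>_def H K)
  ultimately show "power_kernel (a + b) (half_conv f g)"
    unfolding power_kernel_def using H(1) K(1) WI(2)
    by (intro conjI exI[of _ "\<lambda>y. \<integral>t. W t * \<phi> (y, t) \<partial>lborel"]) (auto simp: fun_eq_iff)
qed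

section \<open>Algebra and Laplace transforms of convolutions, by nonnegative integrals\<close>

lemma ennreal_half_conv:
  assumes "power_kernel a f" and "power_kernel b g"
  shows "ennreal (half_conv f g y) = (\<integral>\<^sup>+u. ennreal (f u) * ennreal (g (y - u)) \<partial>lborel)"
  unfolding half_conv_eq[OF assms]
  using power_kernel_nonneg[OF assms(1)] power_kernel_nonneg[OF assms(2)]
  by (subst nn_integral_eq_integral[OF conv_integrable[OF assms], symmetric])
    (auto simp: ennreal_mult)

lemma half_conv_commute:
  assumes "power_kernel a f" and "power_kernel b g"
  shows "half_conv f g = half_conv g f"
proof
  fix y
  show "half_conv f g y = half_conv g f y"
    unfolding half_conv_eq[OF assms] half_conv_eq[OF assms(2,1)]
    by (subst lborel_integral_real_affine[of "-1" _ y]) (auto simp: mult.commute)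
qed

lemma half_conv_assoc:
  assumes f: "power_kernel a f" and g: "power_kernel b g" and h: "power_kernel c h"
  shows "half_conv (half_conv f g) h = half_conv f (half_conv g h)"
proof (rule ext)
  fix y
  note [measurable] = power_kernel_measurable[OF f] power_kernel_measurable[OF g]
    power_kernel_measurable[OF h]
  note fg = power_kernel_half_conv[OF f g] and gh = power_kernel_half_conv[OF g h]
  have "ennreal (half_conv (half_conv f g) h y) =
      (\<integral>\<^sup>+v. (\<integral>\<^sup>+u. ennreal (f u) * ennreal (g (v - u)) \<partial>lborel) * ennreal (h (y - v)) \<partial>lborel)"
    by (simp add: ennreal_half_conv[OF fg h] ennreal_half_conv[OF f g])
  also have "\<dots> = (\<integral>\<^sup>+v. (\<integral>\<^sup>+u. ennreal (f u) * ennreal (g (v - u)) * ennreal (h (y - v)) \<partial>lborel) \<partial>lborel)"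
    by (intro nn_integral_cong nn_integral_multc[symmetric]) measurable
  also have "\<dots> = (\<integral>\<^sup>+u. (\<integral>\<^sup>+v. ennreal (f u) * ennreal (g (v - u)) * ennreal (h (y - v)) \<partial>lborel) \<partial>lborel)"
    by (rule lborel_pair.Fubini') measurable
  also have "\<dots> = (\<integral>\<^sup>+u. ennreal (f u) * (\<integral>\<^sup>+v. ennreal (g (v - u)) * ennreal (h (y - v)) \<partial>lborel) \<partial>lborel)"
    by (simp add: mult.assoc nn_integral_cmult)
  also have "\<dots> = (\<integral>\<^sup>+u. ennreal (f u) * (\<integral>\<^sup>+w. ennreal (g w) * ennreal (h (y - u - w)) \<partial>lborel) \<partial>lborel)"
  proof (rule nn_integral_cong)
    fix u :: real
    have "(\<integral>\<^sup>+v. ennreal (g (v - u)) * ennreal (h (y - v)) \<partial>lborel) =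
        (\<integral>\<^sup>+w. ennreal (g w) * ennreal (h (y - u - w)) \<partial>lborel)"
      by (subst nn_integral_real_affine[of _ 1 u]) (auto simp: algebra_simps)
    then show "ennreal (f u) * (\<integral>\<^sup>+v. ennreal (g (v - u)) * ennreal (h (y - v)) \<partial>lborel) =
        ennreal (f u) * (\<integral>\<^sup>+w. ennreal (g w) * ennreal (h (y - u - w)) \<partial>lborel)"
      by simp
  qed
  also have "\<dots> = ennreal (half_conv f (half_conv g h) y)"
    by (simp add: ennreal_half_conv[OF f gh] ennreal_half_conv[OF g h])
  finally show "half_conv (half_conv f g) h y = half_conv f (half_conv g h) y"
    using power_kernel_nonneg[OF power_kernel_half_conv[OF fg h]]
      power_kernel_nonneg[OF power_kernel_half_conv[OF f gh]] by simp
qed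

text \<open>Split \<open>exp (- s * y)\<close> as
  \<open>exp (- s * u) * exp (- s * (y - u))\<close>, exchange the integrals and translate. With
  values in \<open>ennreal\<close> this covers every real \<open>s\<close>; finiteness enters only
  with the explicit gamma transforms.\<close>

lemma nn_laplace_half_conv:
  assumes f: "power_kernel a f" and g: "power_kernel b g"
  shows "(\<integral>\<^sup>+y. ennreal (exp (- s * y) * half_conv f g y) \<partial>lborel) =
    (\<integral>\<^sup>+y. ennreal (exp (- s * y) * f y) \<partial>lborel) * (\<integral>\<^sup>+y. ennreal (exp (- s * y) * g y) \<partial>lborel)"
proof -
  note [measurable] = power_kernel_measurable[OF f] power_kernel_measurable[OF g]
  note nn = power_kernel_nonneg[OF f] power_kernel_nonneg[OF g]
  have e: "exp (- (s * y)) = exp (- (s * u)) * exp (- (s * (y - u)))" for y u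
    by (simp flip: exp_add add: algebra_simps)
  have "(\<integral>\<^sup>+y. ennreal (exp (- s * y) * half_conv f g y) \<partial>lborel) =
      (\<integral>\<^sup>+y. (\<integral>\<^sup>+u. ennreal (exp (- s * u) * f u) * ennreal (exp (- s * (y - u)) * g (y - u)) \<partial>lborel) \<partial>lborel)"
  proof (intro nn_integral_cong)
    fix y
    have "ennreal (exp (- s * y) * half_conv f g y) =
        ennreal (exp (- s * y)) * (\<integral>\<^sup>+u. ennreal (f u) * ennreal (g (y - u)) \<partial>lborel)"
      by (simp add: ennreal_mult power_kernel_nonneg[OF power_kernel_half_conv[OF f g]]
          ennreal_half_conv[OF f g])
    also have "\<dots> = (\<integral>\<^sup>+u. ennreal (exp (- s * y)) * (ennreal (f u) * ennreal (g (y - u))) \<partial>lborel)"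
      by (rule nn_integral_cmult[symmetric]) measurable
    also have "\<dots> = (\<integral>\<^sup>+u. ennreal (exp (- s * u) * f u) * ennreal (exp (- s * (y - u)) * g (y - u)) \<partial>lborel)"
    proof (intro nn_integral_cong)
      fix u
      show "ennreal (exp (- s * y)) * (ennreal (f u) * ennreal (g (y - u))) =
          ennreal (exp (- s * u) * f u) * ennreal (exp (- s * (y - u)) * g (y - u))"
        using nn e[of y u] by (simp add: ac_simps flip: ennreal_mult)
    qed
    finally show "ennreal (exp (- s * y) * half_conv f g y) =
      (\<integral>\<^sup>+u. ennreal (exp (- s * u) * f u) * ennreal (exp (- s * (y - u)) * g (y - u)) \<partial>lborel)" .
  qed
  also have "\<dots> = (\<integral>\<^sup>+u. (\<integral>\<^sup>+y. ennreal (exp (- s * u) * f u) * ennreal (exp (- s * (y - u)) * g (y - u)) \<partial>lborel) \<partial>lborel)"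
    by (rule lborel_pair.Fubini') measurable
  also have "\<dots> = (\<integral>\<^sup>+u. ennreal (exp (- s * u) * f u) * (\<integral>\<^sup>+y. ennreal (exp (- s * y) * g y) \<partial>lborel) \<partial>lborel)"
  proof (intro nn_integral_cong)
    fix u
    have "(\<integral>\<^sup>+y. ennreal (exp (- s * (y - u)) * g (y - u)) \<partial>lborel) = (\<integral>\<^sup>+y. ennreal (exp (- s * y) * g y) \<partial>lborel)"
      by (subst nn_integral_real_affine[of _ 1 u]) auto
    then show "(\<integral>\<^sup>+y. ennreal (exp (- s * u) * f u) * ennreal (exp (- s * (y - u)) * g (y - u)) \<partial>lborel) =
       ennreal (exp (- s * u) * f u) * (\<integral>\<^sup>+y. ennreal (exp (- s * y) * g y) \<partial>lborel)"
      by (subst nn_integral_cmult) auto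
  qed
  also have "\<dots> = (\<integral>\<^sup>+y. ennreal (exp (- s * y) * f y) \<partial>lborel) * (\<integral>\<^sup>+y. ennreal (exp (- s * y) * g y) \<partial>lborel)"
    by (rule nn_integral_multc) measurable
  finally show ?thesis .
qed

lemma Gamma_nn_integral:
  assumes "d > 0"
  shows "(\<integral>\<^sup>+t. ennreal (indicator {0..} t * (t powr (d - 1) / exp t)) \<partial>lborel) = ennreal (Gamma d)"
proof -
  have "(\<lambda>t. indicator {0..} t * (t powr (d - 1) / exp t)) = 
      (\<lambda>t. if t \<in> {0..} then t powr (d - 1) / exp t else 0)"
    by (auto simp: fun_eq_iff)
  then have "((\<lambda>t. indicator {0..} t * (t powr (d - 1) / exp t)) has_integral Gamma d) UNIV"
    using Gamma_integral_real[OF assms] by (simp only: has_integral_restrict_UNIV)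
  then show ?thesis
    by (intro nn_integral_has_integral_lborel) auto
qed

lemma nn_laplace_gamma_kernel:
  assumes d: "d > 0" and s: "s + \<rho> > 0"
  shows "(\<integral>\<^sup>+y. ennreal (exp (- s * y) * gamma_kernel \<rho> d y) \<partial>lborel) = ennreal ((s + \<rho>) powr (- d))"
proof -
  define c where "c = s + \<rho>"
  have c: "c > 0" using s by (simp add: c_def)
  have G: "Gamma d > 0" using d by (rule Gamma_real_pos)
  have "ennreal (Gamma d) = ennreal \<bar>c\<bar> *
      (\<integral>\<^sup>+y. ennreal (indicator {0..} (0 + c * y) * ((0 + c * y) powr (d - 1) / exp (0 + c * y))) \<partial>lborel)"
    unfolding Gamma_nn_integral[OF d, symmetric] using c
    by (subst nn_integral_real_affine[of _ c 0]) auto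
  also have "\<dots> = ennreal c * (\<integral>\<^sup>+y. ennreal (Gamma d * c powr (d - 1)) *
      ennreal (exp (- s * y) * gamma_kernel \<rho> d y) \<partial>lborel)"
  proof (intro arg_cong2[where f="(*)"] nn_integral_cong)
    fix y
    have "indicator {0..} (0 + c * y) * ((0 + c * y) powr (d - 1) / exp (0 + c * y)) =
      (Gamma d * c powr (d - 1)) * (exp (- s * y) * gamma_kernel \<rho> d y)"
    proof (cases "y > 0")
      case True
      have "exp (- s * y) * exp (- \<rho> * y) = inverse (exp (c * y))"
        by (simp flip: exp_add exp_minus add: c_def algebra_simps)
      then show ?thesis
        using True c G by (simp add: gamma_kernel_def powr_mult field_simps)
    next
      case False
      then have "indicator {0..} (c * y) * (c * y) powr (d - 1) = 0"
        using c by (cases "y = 0") (auto simp: indicator_def zero_le_mult_iff)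
      then show ?thesis
        using False by (simp add: gamma_kernel_def)
    qed
    then show "ennreal (indicator {0..} (0 + c * y) * ((0 + c * y) powr (d - 1) / exp (0 + c * y))) =
      ennreal (Gamma d * c powr (d - 1)) * ennreal (exp (- s * y) * gamma_kernel \<rho> d y)"
      using power_kernel_nonneg[OF power_kernel_gamma[OF d]] G
      by (simp flip: ennreal_mult)
  qed (use c in auto)
  also have "\<dots> = ennreal (Gamma d * c powr d) * (\<integral>\<^sup>+y. ennreal (exp (- s * y) * gamma_kernel \<rho> d y) \<partial>lborel)"
  proof -
    have m: "(\<lambda>y. ennreal (exp (- s * y) * gamma_kernel \<rho> d y)) \<in> borel_measurable lborel"
      using power_kernel_measurable[OF power_kernel_gamma[OF d]] by measurable
    have "ennreal (Gamma d * c powr d) = ennreal c * ennreal (Gamma d * c powr (d - 1))"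
      using c G by (simp flip: ennreal_mult add: powr_diff)
    then show ?thesis
      by (simp only: nn_integral_cmult[OF m] mult.assoc)
  qed
  finally have "ennreal (Gamma d) =
    ennreal (Gamma d * c powr d) * (\<integral>\<^sup>+y. ennreal (exp (- s * y) * gamma_kernel \<rho> d y) \<partial>lborel)" .
  then have "ennreal (1 / (Gamma d * c powr d)) * ennreal (Gamma d) =
    (ennreal (1 / (Gamma d * c powr d)) * ennreal (Gamma d * c powr d)) *
      (\<integral>\<^sup>+y. ennreal (exp (- s * y) * gamma_kernel \<rho> d y) \<partial>lborel)"
    by (simp only: mult.assoc)
  then show ?thesis
    using c G by (simp flip: ennreal_mult add: c_def powr_minus inverse_eq_divide)
qed

section \<open>Linear relations, multiplication by the variable, primitives\<close>

text \<open>Since \<open>r\<close> may be negative, \<open>f + r * g\<close> does not lie in the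
  class automatically; hence the combination is given as a power kernel \<open>F\<close> of its
  own.\<close>

lemma half_conv_lincomb_left:
  assumes f: "power_kernel a f" and g: "power_kernel b g" and k: "power_kernel c k"
    and F: "power_kernel a' F" and eq: "\<And>y. f y + r * g y = F y"
  shows "half_conv f k y + r * half_conv g k y = half_conv F k y"
  unfolding half_conv_eq[OF f k] half_conv_eq[OF g k] half_conv_eq[OF F k]
  by (subst Bochner_Integration.integral_mult_right_zero[symmetric],
      subst Bochner_Integration.integral_add[symmetric])
    (auto simp: conv_integrable[OF f k] conv_integrable[OF g k] eq[symmetric] algebra_simps)

lemma half_conv_lincomb_right:
  assumes f: "power_kernel a f" and g: "power_kernel b g" and k: "power_kernel c k"
    and F: "power_kernel a' F" and eq: "\<And>y. f y + r * g y = F y"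
  shows "half_conv k f y + r * half_conv k g y = half_conv k F y"
  using half_conv_lincomb_left[OF f g k F eq]
  by (simp add: half_conv_commute[OF k f] half_conv_commute[OF k g] half_conv_commute[OF k F])

text \<open>Write \<open>y = u + (y - u)\<close> under the integral: multiplication by the variable
  is a derivation for convolution.\<close>

lemma half_conv_times:
  assumes f: "power_kernel a f" and g: "power_kernel b g"
  shows "y * half_conv f g y = half_conv (\<lambda>u. u * f u) g y + half_conv f (\<lambda>u. u * g u) y"
proof -
  note f' = power_kernel_times[OF f] and g' = power_kernel_times[OF g]
  have "y * half_conv f g y = (\<integral>u. y * (f u * g (y - u)) \<partial>lborel)"
    by (simp add: half_conv_eq[OF f g])
  also have "\<dots> = (\<integral>u. u * f u * g (y - u) + f u * ((y - u) * g (y - u)) \<partial>lborel)"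
    by (intro Bochner_Integration.integral_cong refl) (simp add: algebra_simps)
  also have "\<dots> = half_conv (\<lambda>u. u * f u) g y + half_conv f (\<lambda>u. u * g u) y"
    unfolding half_conv_eq[OF f' g] half_conv_eq[OF f g']
    by (rule Bochner_Integration.integral_add[OF conv_integrable[OF f' g] conv_integrable[OF f g']])
  finally show ?thesis .
qed

text \<open>The Heaviside function as a gamma kernel: taking the primitive from \<open>0\<close>
  becomes a convolution inside the class and commutes with all others.\<close>

abbreviation unit_step :: "real \<Rightarrow> real" where
  "unit_step \<equiv> gamma_kernel 0 1"

lemma power_kernel_unit_step: "power_kernel 1 unit_step"
  by (rule power_kernel_gamma) simp

lemma unit_step_eq: "unit_step y = indicator {0<..} y"
  by (simp add: gamma_kernel_def indicator_def)

lemma half_conv_unit_step: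
  assumes f: "power_kernel a f"
  shows "set_integrable lborel {0..y} f" and "half_conv f unit_step y = integral {0..y} f"
proof -
  have eq: "(\<lambda>u. f u * unit_step (y - u)) = (\<lambda>u. indicator {0..<y} u *\<^sub>R f u)"
    using power_kernel_nonpos[OF f] by (auto simp: fun_eq_iff unit_step_eq indicator_def)
  have ae: "AE u in lborel. indicator {0..<y} u *\<^sub>R f u = indicator {0..y} u *\<^sub>R f u"
    using AE_lborel_singleton[of y] by eventually_elim (auto simp: indicator_def)
  have [measurable]: "f \<in> borel_measurable borel"
    by (rule power_kernel_measurable[OF f])
  have "integrable lborel (\<lambda>u. indicator {0..<y} u *\<^sub>R f u)"
    using conv_integrable[OF f power_kernel_unit_step, of y] unfolding eq .
  then show int: "set_integrable lborel {0..y} f"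
    unfolding set_integrable_def using ae
    by (subst integrable_cong_AE[of _ _ "\<lambda>u. indicator {0..<y} u *\<^sub>R f u"]) auto
  have "half_conv f unit_step y = (\<integral>u. indicator {0..<y} u *\<^sub>R f u \<partial>lborel)"
    unfolding half_conv_eq[OF f power_kernel_unit_step] eq ..
  also have "\<dots> = (LBINT u:{0..y}. f u)"
    unfolding set_lebesgue_integral_def using ae by (intro integral_cong_AE) auto
  also have "\<dots> = integral {0..y} f"
    by (rule set_borel_integral_eq_integral(2)[OF int])
  finally show "half_conv f unit_step y = integral {0..y} f" .
qed

lemma has_derivative_half_conv_unit_step:
  assumes f: "power_kernel a f" and y: "y > 0"
  shows "(half_conv f unit_step has_real_derivative f y) (at y)"
proof -
  \<comment> \<open>\<open>f\<close> may be unbounded at \<open>0\<close>, so the fundamental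
    theorem is applied from a base point strictly between \<open>0\<close> and \<open>y\<close>; the
    integral over \<open>{0..c}\<close> is a constant.\<close>
  define c where "c = y / 2"
  have c: "0 < c" "c < y" using y by (auto simp: c_def)
  have int: "f integrable_on {0..x}" for x
    by (rule set_borel_integral_eq_integral(1)[OF half_conv_unit_step(1)[OF f]])
  have "continuous_on {c..y + 1} f"
    using c by (intro continuous_on_subset[OF power_kernel_continuous[OF f]]) auto
  then have "((\<lambda>x. integral {c..x} f) has_real_derivative f y) (at y within {c..y + 1})"
    using c by (intro integral_has_real_derivative) auto
  then have "((\<lambda>x. integral {c..x} f) has_real_derivative f y) (at y)"
    using c by (subst (asm) at_within_interior) auto
  then have D: "((\<lambda>x. integral {0..c} f + integral {c..x} f) has_real_derivative f y) (at y)"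
    by (auto intro!: derivative_eq_intros)
  show ?thesis
  proof (rule DERIV_cong_ev[THEN iffD1, OF refl _ refl D])
    have "eventually (\<lambda>x. x \<in> {c<..}) (nhds y)"
      using c by (intro eventually_nhds_in_open) auto
    then show "\<forall>\<^sub>F x in nhds y. integral {0..c} f + integral {c..x} f = half_conv f unit_step x"
    proof eventually_elim
      case (elim x)
      then show ?case
        using c by (simp add: half_conv_unit_step(2)[OF f] Henstock_Kurzweil_Integration.integral_combine[OF _ _ int])
    qed
  qed
qed

lemma gamma_kernel_times:
  assumes "d > 0" shows "y * gamma_kernel \<rho> d y = d * gamma_kernel \<rho> (d + 1) y"
proof (cases "y > 0")
  case True
  have "Gamma (d + 1) = d * Gamma d"
    using assms by (intro Gamma_plus1) (auto elim: nonpos_Ints_cases)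
  moreover have "y * y powr (d - 1) = y powr d"
    using True by (simp add: powr_mult_base)
  ultimately show ?thesis
    using assms Gamma_real_pos[OF assms] True by (simp add: gamma_kernel_def field_simps)
qed (simp add: gamma_kernel_def)

lemma gamma_kernel_ode:
  assumes d: "d > 0"
  shows "gamma_kernel \<rho> (d + 1) y + \<rho> * half_conv (gamma_kernel \<rho> (d + 1)) unit_step y =
    half_conv (gamma_kernel \<rho> d) unit_step y"
proof (cases "y > 0")
  case y: True
  have d1: "d + 1 > 0" using d by simp
  note k = power_kernel_gamma[OF d, of \<rho>] and k1 = power_kernel_gamma[OF d1, of \<rho>]
  have int: "gamma_kernel \<rho> d integrable_on {0..y}" "gamma_kernel \<rho> (d + 1) integrable_on {0..y}"
    by (rule set_borel_integral_eq_integral(1)[OF half_conv_unit_step(1)[OF k]],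
        rule set_borel_integral_eq_integral(1)[OF half_conv_unit_step(1)[OF k1]])
  define G where "G y = y powr d * exp (- \<rho> * y) / Gamma (d + 1)" for y
  have G: "gamma_kernel \<rho> (d + 1) u = G u" if "u \<ge> 0" for u
    using that by (auto simp: gamma_kernel_def G_def indicator_def)
  have Gp: "Gamma (d + 1) = d * Gamma d" "Gamma d > 0"
    using d by (auto intro!: Gamma_plus1 Gamma_real_pos elim: nonpos_Ints_cases)
  have Gn: "Gamma d \<noteq> 0" "Gamma (d + 1) \<noteq> 0"
    using Gp d by (metis less_irrefl, metis less_irrefl mult_eq_0_iff)
  \<comment> \<open>\<open>G\<close> is continuous on \<open>{0..y}\<close> because
    \<open>d > 0\<close>, but for \<open>d < 1\<close> its derivative blows up at \<open>0\<close>;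
    hence the fundamental theorem with derivatives in the interior only.\<close>
  have "((\<lambda>u. gamma_kernel \<rho> d u - \<rho> * gamma_kernel \<rho> (d + 1) u) has_integral G y - G 0) {0..y}"
  proof (rule fundamental_theorem_of_calculus_interior)
    have "continuous_on {0..y} (\<lambda>y. y powr d)"
      using d by (intro continuous_on_powr' continuous_intros) auto
    then show "continuous_on {0..y} G"
      unfolding G_def using Gn by (auto intro!: continuous_intros)
    fix x assume x: "x \<in> {0<..<y}"
    have "(G has_real_derivative (d * x powr (d - 1) * exp (- \<rho> * x) +
        x powr d * (- \<rho> * exp (- \<rho> * x))) / Gamma (d + 1)) (at x)"
      unfolding G_def using x Gp Gn d
      by (auto intro!: derivative_eq_intros simp: field_simps powr_diff)
    moreover have "(d * x powr (d - 1) * exp (- \<rho> * x) +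
        x powr d * (- \<rho> * exp (- \<rho> * x))) / Gamma (d + 1) =
        gamma_kernel \<rho> d x - \<rho> * gamma_kernel \<rho> (d + 1) x"
      using x Gp Gn d by (simp add: gamma_kernel_def field_simps)
    ultimately show "(G has_vector_derivative gamma_kernel \<rho> d x - \<rho> * gamma_kernel \<rho> (d + 1) x) (at x)"
      by (simp add: has_real_derivative_iff_has_vector_derivative)
  qed (use y in auto)
  moreover have "((\<lambda>u. gamma_kernel \<rho> d u - \<rho> * gamma_kernel \<rho> (d + 1) u) has_integral
      integral {0..y} (gamma_kernel \<rho> d) - \<rho> * integral {0..y} (gamma_kernel \<rho> (d + 1))) {0..y}"
    using int by (intro has_integral_diff has_integral_mult_right integrable_integral)
  ultimately have "G y - G 0 = integral {0..y} (gamma_kernel \<rho> d) - \<rho> * integral {0..y} (gamma_kernel \<rho> (d + 1))"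
    by (rule has_integral_unique)
  then show ?thesis
    using y d by (simp add: half_conv_unit_step(2)[OF k] half_conv_unit_step(2)[OF k1] G)
      (simp add: G_def)
next
  case False
  then show ?thesis
    using d power_kernel_nonpos[OF power_kernel_half_conv[OF power_kernel_gamma power_kernel_unit_step], of d y \<rho>]
      power_kernel_nonpos[OF power_kernel_half_conv[OF power_kernel_gamma power_kernel_unit_step], of "d + 1" y \<rho>]
    by (simp add: gamma_kernel_def)
qed

section \<open>Convolutions of gamma kernels\<close>

definition gamma_conv :: "nat \<Rightarrow> (nat \<Rightarrow> real) \<Rightarrow> (nat \<Rightarrow> real) \<Rightarrow> real \<Rightarrow> real" where
  "gamma_conv q \<rho> e = iter_conv q (\<lambda>h. gamma_kernel (\<rho> h) (e h))"

lemma gamma_conv_1: "gamma_conv (Suc 0) \<rho> e = gamma_kernel (\<rho> 1) (e 1)"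
  by (simp add: gamma_conv_def iter_conv_def)

lemma gamma_conv_Suc:
  "q \<ge> 1 \<Longrightarrow> gamma_conv (Suc q) \<rho> e =
     half_conv (gamma_conv q \<rho> e) (gamma_kernel (\<rho> (Suc q)) (e (Suc q)))"
  by (simp add: gamma_conv_def iter_conv_def)

lemma gamma_conv_cong:
  assumes "q \<ge> 1" and "\<And>h. h \<in> {1..q} \<Longrightarrow> e h = e' h"
  shows "gamma_conv q \<rho> e = gamma_conv q \<rho> e'"
  using assms
proof (induction q rule: nat_induct_at_least)
  case (Suc q)
  then have "gamma_conv q \<rho> e = gamma_conv q \<rho> e'" "e (Suc q) = e' (Suc q)" by auto
  then show ?case using Suc(1) by (simp add: gamma_conv_Suc)
qed (simp add: gamma_conv_1)

lemma power_kernel_gamma_conv: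
  assumes "q \<ge> 1" and "\<And>h. h \<in> {1..q} \<Longrightarrow> e h > 0"
  shows "power_kernel (\<Sum>h=1..q. e h) (gamma_conv q \<rho> e)"
  using assms
proof (induction q rule: nat_induct_at_least)
  case base
  then show ?case by (simp add: gamma_conv_1 power_kernel_gamma)
next
  case (Suc q)
  then show ?case
    by (simp add: gamma_conv_Suc power_kernel_half_conv power_kernel_gamma)
qed

lemma nn_laplace_gamma_conv:
  assumes "q \<ge> 1" and "\<And>h. h \<in> {1..q} \<Longrightarrow> e h > 0" and "\<And>h. h \<in> {1..q} \<Longrightarrow> s + \<rho> h > 0"
  shows "(\<integral>\<^sup>+y. ennreal (exp (- s * y) * gamma_conv q \<rho> e y) \<partial>lborel) =
    ennreal (\<Prod>h=1..q. (s + \<rho> h) powr (- e h))"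
  using assms
proof (induction q rule: nat_induct_at_least)
  case base
  then show ?case using nn_laplace_gamma_kernel[of "e 1" s "\<rho> 1"] by (simp add: gamma_conv_1)
next
  case (Suc q)
  have pos: "e (Suc q) > 0" "s + \<rho> (Suc q) > 0" using Suc.prems by auto
  have pk: "power_kernel (\<Sum>h=1..q. e h) (gamma_conv q \<rho> e)"
    "power_kernel (e (Suc q)) (gamma_kernel (\<rho> (Suc q)) (e (Suc q)))"
    using Suc.hyps Suc.prems pos by (auto intro: power_kernel_gamma power_kernel_gamma_conv[simplified])
  note L = nn_laplace_gamma_kernel[OF pos]
  show ?case
    using Suc by (simp add: gamma_conv_Suc nn_laplace_half_conv[OF pk, simplified] L[simplified]
        prod_nonneg flip: ennreal_mult)
qed

text \<open>The product rule \<open>half_conv_times\<close>, combined with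
  \<open>y * g = e * g'\<close> for a single kernel, where \<open>g'\<close> has its exponent raised
  by one.\<close>

lemma gamma_conv_times:
  assumes "q \<ge> 1" and "\<And>h. h \<in> {1..q} \<Longrightarrow> e h > 0"
  shows "y * gamma_conv q \<rho> e y = (\<Sum>h=1..q. e h * gamma_conv q \<rho> (e(h := e h + 1)) y)"
  using assms
proof (induction q arbitrary: y rule: nat_induct_at_least)
  case base
  then show ?case by (simp add: gamma_conv_1 gamma_kernel_times)
next
  case (Suc q)
  define g where "g = gamma_kernel (\<rho> (Suc q)) (e (Suc q))"
  have eS: "e (Suc q) > 0" "e (Suc q) + 1 > 0" using Suc.prems by (auto intro: add_pos_pos)
  have e: "e h > 0" if "h \<in> {1..q}" for h using that Suc.prems by auto
  have T: "power_kernel (\<Sum>h=1..q. e h) (gamma_conv q \<rho> e)"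
    using Suc(1) e by (rule power_kernel_gamma_conv)
  have T': "power_kernel (\<Sum>k=1..q. (e(h := e h + 1)) k) (gamma_conv q \<rho> (e(h := e h + 1)))" for h
    using Suc(1) e by (intro power_kernel_gamma_conv) (auto intro: add_pos_pos)
  have g: "power_kernel (e (Suc q)) g" unfolding g_def by (rule power_kernel_gamma[OF eS(1)])
  have g': "power_kernel (e (Suc q) + 1) (gamma_kernel (\<rho> (Suc q)) (e (Suc q) + 1))"
    by (rule power_kernel_gamma[OF eS(2)])
  have "half_conv (\<lambda>u. u * gamma_conv q \<rho> e u) g y =
     (\<Sum>h=1..q. e h * half_conv (gamma_conv q \<rho> (e(h := e h + 1))) g y)"
  proof -
    have "half_conv (\<lambda>u. u * gamma_conv q \<rho> e u) g y =
        (\<integral>u. (\<Sum>h=1..q. e h * (gamma_conv q \<rho> (e(h := e h + 1)) u * g (y - u))) \<partial>lborel)"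
      unfolding half_conv_eq[OF power_kernel_times[OF T] g]
      by (intro Bochner_Integration.integral_cong refl) (simp only: Suc.IH[OF e] sum_distrib_right mult.assoc)
    also have "\<dots> = (\<Sum>h=1..q. (\<integral>u. e h * (gamma_conv q \<rho> (e(h := e h + 1)) u * g (y - u)) \<partial>lborel))"
      by (intro Bochner_Integration.integral_sum integrable_mult_right conv_integrable[OF T' g])
    finally show ?thesis
      by (simp add: half_conv_eq[OF T' g])
  qed
  also have "\<dots> = (\<Sum>h=1..q. e h * gamma_conv (Suc q) \<rho> (e(h := e h + 1)) y)"
    using Suc(1) by (intro sum.cong) (auto simp: gamma_conv_Suc g_def)
  finally have 1: "half_conv (\<lambda>u. u * gamma_conv q \<rho> e u) g y = \<dots>" .
  have "half_conv (gamma_conv q \<rho> e) (\<lambda>u. u * g u) y =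
     e (Suc q) * half_conv (gamma_conv q \<rho> e) (gamma_kernel (\<rho> (Suc q)) (e (Suc q) + 1)) y"
    unfolding half_conv_eq[OF T power_kernel_times[OF g]] half_conv_eq[OF T g']
    by (simp add: g_def gamma_kernel_times[OF eS(1)] mult.left_commute)
  also have "\<dots> = e (Suc q) * gamma_conv (Suc q) \<rho> (e(Suc q := e (Suc q) + 1)) y"
    using Suc(1) gamma_conv_cong[OF Suc(1), of "e(Suc q := e (Suc q) + 1)" e \<rho>]
    by (simp add: gamma_conv_Suc)
  finally have 2: "half_conv (gamma_conv q \<rho> e) (\<lambda>u. u * g u) y = \<dots>" .
  show ?case
    using half_conv_times[OF T g, of y] Suc(1) by (simp add: 1 2 gamma_conv_Suc[of q \<rho> e] del: fun_upd_apply flip: g_def)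
qed

text \<open>The relation \<open>(d/dy + \<rho> h) g' = g\<close> between convolutions \<open>g'\<close>, \<open>g\<close> with exponents \<open>e h + 1\<close>, \<open>e h\<close>,
  integrated once: the integral form makes sense also where \<open>g\<close> is unbounded near \<open>0\<close>.\<close>

lemma gamma_conv_ode:
  assumes "q \<ge> 1" and "\<And>h. h \<in> {1..q} \<Longrightarrow> e h > 0" and "h \<in> {1..q}"
  shows "gamma_conv q \<rho> (e(h := e h + 1)) y +
      \<rho> h * half_conv (gamma_conv q \<rho> (e(h := e h + 1))) unit_step y =
    half_conv (gamma_conv q \<rho> e) unit_step y"
  using assms
proof (induction q arbitrary: y rule: nat_induct_at_least)
  case base
  then show ?case using gamma_kernel_ode[of "e 1" "\<rho> 1" y] by (simp add: gamma_conv_1)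
next
  case (Suc q)
  define g where "g = gamma_kernel (\<rho> (Suc q)) (e (Suc q))"
  define g' where "g' = gamma_kernel (\<rho> (Suc q)) (e (Suc q) + 1)"
  let ?T = "gamma_conv q \<rho> e" and ?T' = "gamma_conv q \<rho> (e(h := e h + 1))"
  have eS: "e (Suc q) > 0" "e (Suc q) + 1 > 0" using Suc.prems by (auto intro: add_pos_pos)
  have e: "e h > 0" if "h \<in> {1..q}" for h using that Suc.prems by auto
  have T: "power_kernel (\<Sum>h=1..q. e h) ?T"
    using Suc(1) e by (rule power_kernel_gamma_conv)
  have T': "power_kernel (\<Sum>k=1..q. (e(h := e h + 1)) k) ?T'"
    using Suc(1) e by (intro power_kernel_gamma_conv) (auto intro: add_pos_pos)
  have g: "power_kernel (e (Suc q)) g" unfolding g_def by (rule power_kernel_gamma[OF eS(1)])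
  have g': "power_kernel (e (Suc q) + 1) g'"
    unfolding g'_def by (rule power_kernel_gamma[OF eS(2)])
  note st = power_kernel_unit_step
  note Tst = power_kernel_half_conv[OF T st] and T'st = power_kernel_half_conv[OF T' st]
  note gst = power_kernel_half_conv[OF g st] and g'st = power_kernel_half_conv[OF g' st]
  \<comment> \<open>Integration moves past the last factor, so that the relation for the first
    \<open>q\<close> factors can be convolved with \<open>g\<close>.\<close>
  have swap: "half_conv (half_conv f unit_step) g = half_conv (half_conv f g) unit_step"
    if f: "power_kernel a f" for a f
    using half_conv_assoc[OF f st g] half_conv_assoc[OF f g st] half_conv_commute[OF st g] by simp
  show ?case
  proof (cases "h = Suc q")
    case True
    have "half_conv ?T g' y + \<rho> h * half_conv ?T (half_conv g' unit_step) y = half_conv ?T (half_conv g unit_step) y"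
      using True eS(1) by (intro half_conv_lincomb_right[OF g' g'st T gst])
       (simp add: g_def g'_def gamma_kernel_ode)
    then show ?thesis
      using True Suc(1) gamma_conv_cong[OF Suc(1), of "e(Suc q := e (Suc q) + 1)" e \<rho>]
      by (simp add: gamma_conv_Suc half_conv_assoc[OF T g' st, symmetric] half_conv_assoc[OF T g st, symmetric]
          del: fun_upd_apply flip: g_def g'_def) (simp add: g'_def)
  next
    case False
    then have h: "h \<in> {1..q}" using Suc.prems by auto
    have "half_conv ?T' g y + \<rho> h * half_conv (half_conv ?T' unit_step) g y = half_conv (half_conv ?T unit_step) g y"
      by (intro half_conv_lincomb_left[OF T' T'st g Tst] Suc.IH[OF e h])
    then show ?thesis
      using False Suc(1) by (simp add: gamma_conv_Suc swap[OF T] swap[OF T'] del: fun_upd_apply flip: g_def)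
        (simp flip: g_def)
  qed
qed

text \<open>The integrated relation writes the convolution as a combination of two primitives whose
  integrands are continuous on \<open>y > 0\<close>; differentiability follows without any prior
  regularity.\<close>

lemma gamma_conv_has_derivative:
  assumes q: "q \<ge> 1" and e: "\<And>h. h \<in> {1..q} \<Longrightarrow> e h > 0" and h: "h \<in> {1..q}" and y: "y > 0"
  shows "(gamma_conv q \<rho> (e(h := e h + 1)) has_real_derivative
    gamma_conv q \<rho> e y - \<rho> h * gamma_conv q \<rho> (e(h := e h + 1)) y) (at y)"
proof -
  let ?T = "gamma_conv q \<rho> e" and ?T' = "gamma_conv q \<rho> (e(h := e h + 1))"
  have T: "power_kernel (\<Sum>h=1..q. e h) ?T"
    using q e by (rule power_kernel_gamma_conv)
  have T': "power_kernel (\<Sum>k=1..q. (e(h := e h + 1)) k) ?T'"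
    using q e by (intro power_kernel_gamma_conv) (auto intro: add_pos_pos)
  have "?T' = (\<lambda>y. half_conv ?T unit_step y - \<rho> h * half_conv ?T' unit_step y)"
  proof
    fix y show "?T' y = half_conv ?T unit_step y - \<rho> h * half_conv ?T' unit_step y"
      using gamma_conv_ode[of q e h \<rho> y] q e h by simp
  qed
  moreover have "((\<lambda>y. half_conv ?T unit_step y - \<rho> h * half_conv ?T' unit_step y) has_real_derivative
      ?T y - \<rho> h * ?T' y) (at y)"
    by (intro DERIV_diff DERIV_cmult has_derivative_half_conv_unit_step[OF T y]
        has_derivative_half_conv_unit_step[OF T' y])
  ultimately show ?thesis by simp
qed

section \<open>Polynomial families and polynomial vectors\<close>

lemma smult_sum_right: "smult c (\<Sum>i\<in>A. f i) = (\<Sum>i\<in>A. smult c (f i))"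
  by (induction A rule: infinite_finite_induct) (auto simp: smult_add_right)

text \<open>Gaussian elimination on the highest admissible coefficient. Bounding coefficients
  instead of \<open>degree\<close> makes \<open>N = 0\<close> mean that all members vanish.\<close>

lemma poly_family_dependent:
  fixes f :: "'i \<Rightarrow> 'a::field poly"
  assumes "finite I" and "card I > N" and "\<And>i r. i \<in> I \<Longrightarrow> r \<ge> N \<Longrightarrow> coeff (f i) r = 0"
  shows "\<exists>c. (\<exists>i\<in>I. c i \<noteq> 0) \<and> (\<Sum>i\<in>I. smult (c i) (f i)) = 0"
  using assms
proof (induction N arbitrary: I f)
  case 0
  then obtain i where "i \<in> I" by fastforce
  moreover have "f j = 0" if "j \<in> I" for j
    using 0(3)[OF that] by (simp add: poly_eq_iff)
  ultimately show ?case
    by (intro exI[of _ "\<lambda>_. 1"]) auto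
next
  case (Suc N)
  show ?case
  proof (cases "\<exists>i\<in>I. coeff (f i) N \<noteq> 0")
    case False
    have "coeff (f i) r = 0" if "i \<in> I" "r \<ge> N" for i r
      using False that Suc.prems(3)[of i r] by (cases "r = N") auto
    then show ?thesis
      using Suc.prems by (intro Suc.IH) auto
  next
    case True
    then obtain k where k: "k \<in> I" "coeff (f k) N \<noteq> 0" by blast
    define t where "t i = coeff (f i) N / coeff (f k) N" for i
    define g where "g i = f i - smult (t i) (f k)" for i
    have "\<exists>c. (\<exists>i\<in>I - {k}. c i \<noteq> 0) \<and> (\<Sum>i\<in>I - {k}. smult (c i) (g i)) = 0"
    proof (rule Suc.IH)
      fix i r assume "i \<in> I - {k}" "r \<ge> N"
      then show "coeff (g i) r = 0"
        using Suc.prems(3)[of i r] Suc.prems(3)[of k r] k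
        by (cases "r = N") (auto simp: g_def t_def)
    qed (use Suc.prems k in auto)
    then obtain c where c: "\<exists>i\<in>I - {k}. c i \<noteq> 0" "(\<Sum>i\<in>I - {k}. smult (c i) (g i)) = 0" by blast
    \<comment> \<open>The weight of the pivot compensates what was subtracted from the other
      members, so the combination of the \<open>f i\<close> equals that of the
      \<open>g i\<close>.\<close>
    define c' where "c' = c(k := - (\<Sum>i\<in>I - {k}. c i * t i))"
    have "(\<Sum>i\<in>I. smult (c' i) (f i)) = smult (c' k) (f k) + (\<Sum>i\<in>I - {k}. smult (c i) (f i))"
      using Suc.prems(1) k by (simp add: sum.remove[of I k] c'_def)
    also have "(\<Sum>i\<in>I - {k}. smult (c i) (f i)) =
        (\<Sum>i\<in>I - {k}. smult (c i) (g i)) + smult (\<Sum>i\<in>I - {k}. c i * t i) (f k)"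
      by (simp add: g_def smult_sum smult_diff_right sum_subtractf)
    finally have "(\<Sum>i\<in>I. smult (c' i) (f i)) = 0"
      using c by (simp add: c'_def)
    moreover have "\<exists>i\<in>I. c' i \<noteq> 0"
      using c(1) by (auto simp: c'_def)
    ultimately show ?thesis by blast
  qed
qed

text \<open>With \<open>P\<close> as an extra member, indexed by \<open>None\<close>, the family is
  too large for its degree bound; independence of the others forces a nonzero weight at
  \<open>P\<close> in the resulting relation.\<close>

lemma poly_family_spans:
  fixes f :: "'i \<Rightarrow> 'a::field poly"
  assumes I: "finite I" "card I = N" and f: "\<And>i r. i \<in> I \<Longrightarrow> r \<ge> N \<Longrightarrow> coeff (f i) r = 0"
    and indep: "\<And>c. (\<Sum>i\<in>I. smult (c i) (f i)) = 0 \<Longrightarrow> \<forall>i\<in>I. c i = 0"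
    and P: "\<And>r. r \<ge> N \<Longrightarrow> coeff P r = 0"
  shows "\<exists>c. P = (\<Sum>i\<in>I. smult (c i) (f i))"
proof -
  let ?I = "insert None (Some ` I)"
  define g where "g = case_option P f"
  have "\<exists>c. (\<exists>i\<in>?I. c i \<noteq> 0) \<and> (\<Sum>i\<in>?I. smult (c i) (g i)) = 0"
    using I f P by (intro poly_family_dependent[where N = N]) (auto simp: g_def card_image)
  then obtain c where c: "\<exists>i\<in>?I. c i \<noteq> 0" "(\<Sum>i\<in>?I. smult (c i) (g i)) = 0" by blast
  then have eq: "smult (c None) P + (\<Sum>i\<in>I. smult (c (Some i)) (f i)) = 0"
    using I by (simp add: g_def sum.reindex)
  have "c None \<noteq> 0"
    using eq indep[of "\<lambda>i. c (Some i)"] c(1) by auto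
  have "smult (c None) P = - (\<Sum>i\<in>I. smult (c (Some i)) (f i))"
    by (rule add_eq_0_iff2[THEN iffD1, OF eq])
  then have "smult (inverse (c None)) (smult (c None) P) =
      smult (inverse (c None)) (- (\<Sum>i\<in>I. smult (c (Some i)) (f i)))"
    by (rule arg_cong)
  then have "P = smult (- inverse (c None)) (\<Sum>i\<in>I. smult (c (Some i)) (f i))"
    using \<open>c None \<noteq> 0\<close> by simp
  also have "\<dots> = (\<Sum>i\<in>I. smult (- inverse (c None) * c (Some i)) (f i))"
    by (simp add: smult_sum_right)
  finally show ?thesis by (rule exI[of _ "\<lambda>i. - inverse (c None) * c (Some i)"])
qed

lemma linear_power_dvd_mult_cancel:
  fixes P R :: "'a::idom poly"
  assumes "[:- a, 1:] ^ n dvd P * R" and "poly P a \<noteq> 0"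
  shows "[:- a, 1:] ^ n dvd R"
proof (cases "R = 0")
  case False
  have "P * R \<noteq> 0" using False assms(2) by auto
  then show ?thesis
    using assms by (simp add: order_divides order_mult order_0I)
qed simp

lemma prod_linear_powers_dvd:
  fixes a :: "'i \<Rightarrow> 'a::idom"
  assumes "finite S" and "inj_on a {i \<in> S. n i > 0}" and "\<And>i. i \<in> S \<Longrightarrow> [:- a i, 1:] ^ n i dvd P"
  shows "(\<Prod>i\<in>S. [:- a i, 1:] ^ n i) dvd P"
  using assms
proof (induction S rule: finite_induct)
  case (insert k S)
  have "(\<Prod>i\<in>S. [:- a i, 1:] ^ n i) dvd P"
    using insert.prems by (intro insert.IH) (auto intro: inj_on_subset)
  then obtain R where R: "P = (\<Prod>i\<in>S. [:- a i, 1:] ^ n i) * R" by (elim dvdE)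
  have "[:- a k, 1:] ^ n k dvd R"
  proof (cases "n k = 0")
    case False
    have "poly (\<Prod>i\<in>S. [:- a i, 1:] ^ n i) (a k) \<noteq> 0"
    proof
      assume "poly (\<Prod>i\<in>S. [:- a i, 1:] ^ n i) (a k) = 0"
      then obtain i where "i \<in> S" "a k = a i" "n i > 0"
        using insert.hyps by (auto simp: poly_prod)
      then have "k = i"
        using False by (intro inj_onD[OF insert.prems(1)]) auto
      then show False using \<open>i \<in> S\<close> insert.hyps by simp
    qed
    moreover have "[:- a k, 1:] ^ n k dvd (\<Prod>i\<in>S. [:- a i, 1:] ^ n i) * R"
      using insert.prems(2)[of k] R by simp
    ultimately show ?thesis by (rule linear_power_dvd_mult_cancel[rotated])
  qed simp
  then show ?case
    using insert.hyps R by (simp add: mult.commute mult_dvd_mono)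
qed simp

lemma degree_prod_linear_powers:
  fixes a :: "'i \<Rightarrow> 'a::idom"
  shows "degree (\<Prod>i\<in>S. [:a i, 1:] ^ n i) = (\<Sum>i\<in>S. n i)"
  by (subst degree_prod_eq_sum_degree) (auto simp: degree_linear_power)

section \<open>Coordinates of polynomial vectors\<close>

definition coeff_vec :: "nat \<Rightarrow> (nat \<Rightarrow> nat) \<Rightarrow> (nat \<times> nat \<Rightarrow> real) \<Rightarrow> nat \<Rightarrow> real poly" where
  "coeff_vec r n c i = (if i \<in> {1..r} then \<Sum>k<n i. monom (c (i, k)) k else 0)"

text \<open>The positions of the free coefficients of a polynomial vector; dimension counts become
  cardinalities of this set.\<close>

abbreviation slots :: "nat \<Rightarrow> (nat \<Rightarrow> nat) \<Rightarrow> (nat \<times> nat) set" where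
  "slots r n \<equiv> SIGMA i:{1..r}. {..<n i}"

lemma coeff_sum_monom: "coeff (\<Sum>k<n. monom (c k) k) r = (if r < n then c r else 0)"
  by (simp add: coeff_sum coeff_monom sum.delta' flip: lessThan_iff)

lemma coeff_coeff_vec: "(i, k) \<in> slots r n \<Longrightarrow> coeff (coeff_vec r n c i) k = c (i, k)"
  by (auto simp: coeff_vec_def coeff_sum_monom)

lemma coeff_vec_in_poly_vectors: "coeff_vec r n c \<in> poly_vectors r n"
proof -
  have "degree (coeff_vec r n c i) < n i" if "coeff_vec r n c i \<noteq> 0" for i
    using that by (intro degree_lessI) (auto simp: coeff_vec_def coeff_sum_monom split: if_splits)
  moreover have "coeff_vec r n c i = 0" if "i \<notin> {1..r}" for i
    using that by (simp only: coeff_vec_def if_False)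
  ultimately show ?thesis
    by (auto simp: poly_vectors_def)
qed

lemma poly_vectors_coeff:
  assumes "A \<in> poly_vectors r n" and "i \<in> {1..r}" and "k \<ge> n i" shows "coeff (A i) k = 0"
proof (cases "A i = 0")
  case False
  then show ?thesis
    using assms by (intro coeff_eq_0) (auto simp: poly_vectors_def)
qed simp

lemma poly_vectors_eq_0I:
  assumes "A \<in> poly_vectors r n" and "\<And>i k. (i, k) \<in> slots r n \<Longrightarrow> coeff (A i) k = 0"
  shows "A = 0"
proof
  fix i
  show "A i = 0 i"
  proof (cases "i \<in> {1..r}")
    case True
    have "coeff (A i) k = 0" for k
      using assms(2)[of i k] poly_vectors_coeff[OF assms(1) True, of k] True
      by (cases "k < n i") auto
    then show ?thesis by (simp add: poly_eq_iff)
  next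
    case False
    then show ?thesis using assms(1) by (auto simp: poly_vectors_def)
  qed
qed

lemma poly_vectors_poly:
  assumes "A \<in> poly_vectors r n" and "i \<in> {1..r}"
  shows "poly (A i) y = (\<Sum>k<n i. coeff (A i) k * y ^ k)"
proof (cases "A i = 0")
  case False
  then have "degree (A i) < n i" using assms by (auto simp: poly_vectors_def)
  then show ?thesis
    unfolding poly_altdef by (intro sum.mono_neutral_left) (auto simp: coeff_eq_0)
qed simp

lemma poly_vectors_lincomb:
  assumes "A \<in> poly_vectors r n" and "B \<in> poly_vectors r n"
  shows "A - scale_vec c B \<in> poly_vectors r n"
proof -
  have "(A - scale_vec c B) i = 0 \<or> degree ((A - scale_vec c B) i) < n i" if "i \<in> {1..r}" for i
  proof (cases "(A - scale_vec c B) i = 0")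
    case False
    have "coeff ((A - scale_vec c B) i) k = 0" if "k \<ge> n i" for k
      using poly_vectors_coeff[OF assms(1) \<open>i \<in> _\<close> that] poly_vectors_coeff[OF assms(2) \<open>i \<in> _\<close> that]
      by (simp add: scale_vec_def)
    with False show ?thesis
      using degree_lessI[of "(A - scale_vec c B) i" "n i"] by blast
  qed simp
  then show ?thesis
    using assms by (auto simp: poly_vectors_def scale_vec_def)
qed

lemma poly_vectors_scale:
  assumes "A \<in> poly_vectors r n" shows "scale_vec c A \<in> poly_vectors r n"
proof -
  have "degree (smult c (A i)) < n i" if "i \<in> {1..r}" "smult c (A i) \<noteq> 0" for i
    using that assms by (auto simp: poly_vectors_def)
  then show ?thesis
    using assms by (auto simp: poly_vectors_def scale_vec_def)
qed

lemma weakly_normal_line: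
  assumes "v \<noteq> 0" and "V = range (\<lambda>c. scale_vec c v)"
  shows "weakly_normal V" and "vector_space.dim scale_vec V = 1"
proof -
  interpret vector_space scale_vec by (rule vector_space_scale_vec)
  have V: "V = span {v}" using assms(2) by (simp add: span_singleton)
  then show "dim V = 1"
    using assms(1) by (simp add: dim_eq_card_independent)
  with V show "weakly_normal V"
    unfolding weakly_normal_def by (simp add: subspace_span)
qed

section \<open>Iterated derivatives on the open half-line\<close>

lemma deriv_cong_pos:
  fixes f :: "real \<Rightarrow> real"
  assumes "\<And>y. y > 0 \<Longrightarrow> f y = g y" and "y > 0"
  shows "deriv f y = deriv g y"
    and "(f has_real_derivative D) (at y) \<longleftrightarrow> (g has_real_derivative D) (at y)"
proof -
  have "eventually (\<lambda>x. x \<in> {0<..}) (nhds y)"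
    using assms(2) by (intro eventually_nhds_in_open) auto
  then have ev: "eventually (\<lambda>x. f x = g x) (nhds y)"
    by eventually_elim (simp add: assms(1))
  show "deriv f y = deriv g y" by (rule deriv_cong_ev[OF ev refl])
  show "(f has_real_derivative D) (at y) \<longleftrightarrow> (g has_real_derivative D) (at y)"
    by (rule DERIV_cong_ev[OF refl ev refl])
qed

text \<open>\<open>deriv\<close> has a value even where no derivative exists; the explicit functions
  \<open>s r\<close> carry the differentiability along.\<close>

definition derivative_chain :: "nat \<Rightarrow> (real \<Rightarrow> real) \<Rightarrow> (nat \<Rightarrow> real \<Rightarrow> real) \<Rightarrow> bool" where
  "derivative_chain n f s \<longleftrightarrow>
     s 0 = f \<and> (\<forall>r<n. \<forall>y>0. (s r has_real_derivative s (Suc r) y) (at y))"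

lemma derivative_chain_deriv:
  assumes "derivative_chain n f s" and "r \<le> n" and "y > 0"
  shows "(deriv ^^ r) f y = s r y"
  using assms(2,3)
proof (induction r arbitrary: y)
  case 0
  then show ?case using assms(1) by (simp add: derivative_chain_def)
next
  case (Suc r)
  have "(deriv ^^ Suc r) f y = deriv ((deriv ^^ r) f) y" by simp
  also have "\<dots> = deriv (s r) y"
    using Suc by (intro deriv_cong_pos(1)) auto
  also have "\<dots> = s (Suc r) y"
    using Suc.prems assms(1) by (intro DERIV_imp_deriv) (auto simp: derivative_chain_def)
  finally show ?case .
qed

section \<open>Symbols of convolutions\<close>

locale gamma_system =
  fixes q :: nat and d \<rho> :: "nat \<Rightarrow> real"
  assumes q: "q \<ge> 1" and d_pos: "h \<in> {1..q} \<Longrightarrow> d h > 0" and \<rho>_pos: "h \<in> {1..q} \<Longrightarrow> \<rho> h > 0"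
begin

definition T :: "(nat \<Rightarrow> nat) \<Rightarrow> real \<Rightarrow> real" where
  "T l = gamma_conv q \<rho> (\<lambda>h. d h + real (l h))"

abbreviation bump :: "(nat \<Rightarrow> nat) \<Rightarrow> nat \<Rightarrow> nat \<Rightarrow> nat" where
  "bump l h \<equiv> l(h := Suc (l h))"

definition unit_index :: "nat \<Rightarrow> nat \<Rightarrow> nat" where
  "unit_index j h = (if h = j then 1 else 0)"

lemma S_fun_eq_T: "S_fun q \<rho> d m = T m"
  by (simp add: S_fun_def T_def gamma_conv_def)

lemma F_fun_eq_T: "F_fun q \<rho> d j = T (unit_index j)"
proof -
  have "(\<lambda>h. d h + real (unit_index j h)) = (\<lambda>h. d h + (if h = j then 1 else 0))"
    by (auto simp: unit_index_def)
  then show ?thesis by (simp add: F_fun_def T_def gamma_conv_def)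
qed

lemma T_pos_exponent: "h \<in> {1..q} \<Longrightarrow> d h + real (l h) > 0"
  using d_pos[of h] by (simp add: add_pos_nonneg)

lemma bump_exponent:
  "(\<lambda>k. d k + real (bump l h k)) = (\<lambda>k. d k + real (l k))(h := d h + real (l h) + 1)"
  by (auto simp: fun_eq_iff)

lemma T_cong: "(\<And>h. h \<in> {1..q} \<Longrightarrow> l h = l' h) \<Longrightarrow> T l = T l'"
  unfolding T_def by (intro gamma_conv_cong[OF q]) auto

lemma T_power_kernel: "power_kernel (\<Sum>h=1..q. d h + real (l h)) (T l)"
  unfolding T_def using q T_pos_exponent by (rule power_kernel_gamma_conv)

lemma T_times: "y * T l y = (\<Sum>h=1..q. (d h + real (l h)) * T (bump l h) y)"
  unfolding T_def bump_exponent using q T_pos_exponent by (rule gamma_conv_times)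

lemma T_has_derivative:
  assumes "h \<in> {1..q}" and "y > 0"
  shows "(T (bump l h) has_real_derivative T l y - \<rho> h * T (bump l h) y) (at y)"
  unfolding T_def bump_exponent using q T_pos_exponent assms by (rule gamma_conv_has_derivative)

text \<open>One unit of \<open>l\<close> pays for one derivative: the derivative of
  \<open>T (bump l' h)\<close> combines \<open>T l'\<close> with the function itself, and no
  exponent falls below \<open>d h > 0\<close>.\<close>

lemma T_derivative_chain: "n \<le> (\<Sum>h=1..q. l h) \<Longrightarrow> \<exists>s. derivative_chain n (T l) s"
proof (induction n arbitrary: l)
  case 0
  show ?case by (intro exI[of _ "\<lambda>_. T l"]) (simp add: derivative_chain_def)
next
  case (Suc n)
  then obtain h where h: "h \<in> {1..q}" "l h > 0"
    by (metis Suc_le_D not_gr_zero sum.neutral nat.distinct(1))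
  define l' where "l' = l(h := l h - 1)"
  have l: "l = bump l' h" using h by (auto simp: l'_def)
  have "(\<Sum>h=1..q. l h) = Suc (\<Sum>h=1..q. l' h)"
  proof -
    have "(\<Sum>k\<in>{1..q} - {h}. l k) = (\<Sum>k\<in>{1..q} - {h}. l' k)"
      by (intro sum.cong) (auto simp: l'_def)
    then show ?thesis
      using h sum.remove[of "{1..q}" h l] sum.remove[of "{1..q}" h l'] by (simp add: l'_def)
  qed
  then obtain s s' where s: "derivative_chain n (T l) s" "derivative_chain n (T l') s'"
    using Suc.IH[of l] Suc.IH[of l'] Suc.prems by auto
  \<comment> \<open>From order one on, a derivative of \<open>T l\<close> combines derivatives of
    \<open>T l'\<close> and \<open>T l\<close> of one order less; so two chains of length
    \<open>n\<close> yield one of length \<open>Suc n\<close>.\<close>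
  define t where "t r y = (case r of 0 \<Rightarrow> T l y | Suc r \<Rightarrow> s' r y - \<rho> h * s r y)" for r y
  have t: "t 0 = T l" "\<And>r. t (Suc r) = (\<lambda>y. s' r y - \<rho> h * s r y)"
    by (auto simp: t_def)
  have "(t r has_real_derivative t (Suc r) y) (at y)" if "r < Suc n" "y > 0" for r y
  proof (cases r)
    case 0
    then show ?thesis
      using T_has_derivative[OF h(1) that(2), of l'] s by (simp add: t derivative_chain_def flip: l)
  next
    case (Suc r')
    then have "(s' r' has_real_derivative s' (Suc r') y) (at y)"
        "(s r' has_real_derivative s (Suc r') y) (at y)"
      using s that by (auto simp: derivative_chain_def)
    then show ?thesis
      unfolding Suc t by (intro DERIV_diff DERIV_cmult)
  qed
  then show ?case
    using t(1) by (auto simp: derivative_chain_def)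
qed

section \<open>Differential operators with constant coefficients\<close>

text \<open>This is \<open>P(d/dy)\<close> applied to \<open>T m\<close>. The range stops at the
  number of derivatives provided by \<open>T_derivative_chain\<close> and does not depend on
  \<open>P\<close>, which makes the expression linear in \<open>P\<close>.\<close>

definition diff_op :: "(nat \<Rightarrow> nat) \<Rightarrow> real poly \<Rightarrow> real \<Rightarrow> real" where
  "diff_op m P y = (\<Sum>r\<le>(\<Sum>h=1..q. m h). coeff P r * (deriv ^^ r) (T m) y)"

text \<open>\<open>pCons 0 P\<close> is the variable times \<open>P\<close>; the strict degree bound
  keeps its top coefficient inside the range of \<open>diff_op\<close>.\<close>

lemma diff_op_has_derivative:
  assumes "degree P < (\<Sum>h=1..q. m h)" and y: "y > 0"
  shows "(diff_op m P has_real_derivative diff_op m (pCons 0 P) y) (at y)"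
proof -
  define N where "N = (\<Sum>h=1..q. m h)"
  obtain s where s: "derivative_chain N (T m) s"
    using T_derivative_chain[of N m] by (auto simp: N_def)
  obtain N' where N': "N = Suc N'" using assms(1) by (cases N) (auto simp: N_def)
  have D: "((\<lambda>x. \<Sum>r\<le>N'. coeff P r * s r x) has_real_derivative (\<Sum>r\<le>N'. coeff P r * s (Suc r) y)) (at y)"
    using s y N' by (intro DERIV_sum DERIV_cmult) (auto simp: derivative_chain_def)
  have "diff_op m P x = (\<Sum>r\<le>N'. coeff P r * s r x)" if "x > 0" for x
  proof -
    have "diff_op m P x = (\<Sum>r\<le>N. coeff P r * s r x)"
      unfolding diff_op_def N_def[symmetric]
      using derivative_chain_deriv[OF s _ that] by (intro sum.cong) auto
    also have "\<dots> = (\<Sum>r\<le>N'. coeff P r * s r x)"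
      using assms(1) N' by (simp add: coeff_eq_0 N_def)
    finally show ?thesis .
  qed
  moreover have "diff_op m (pCons 0 P) y = (\<Sum>r\<le>N'. coeff P r * s (Suc r) y)"
  proof -
    have "diff_op m (pCons 0 P) y = (\<Sum>r\<le>N. coeff (pCons 0 P) r * s r y)"
      unfolding diff_op_def N_def[symmetric]
      using derivative_chain_deriv[OF s _ y] by (intro sum.cong) auto
    then show ?thesis
      unfolding N' sum.atMost_Suc_shift by simp
  qed
  ultimately show ?thesis
    using D deriv_cong_pos(2)[OF _ y, of "diff_op m P"] by simp
qed

lemma diff_op_add: "diff_op m (P + Q) y = diff_op m P y + diff_op m Q y"
  by (simp add: diff_op_def distrib_right sum.distrib)

lemma diff_op_smult: "diff_op m (smult c P) y = c * diff_op m P y"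
  by (simp add: diff_op_def sum_distrib_left mult.assoc)

lemma diff_op_sum: "diff_op m (\<Sum>i\<in>I. P i) y = (\<Sum>i\<in>I. diff_op m (P i) y)"
  by (induction I rule: infinite_finite_induct) (auto simp: diff_op_add diff_op_def[of _ 0])

lemma diff_op_linear_factor:
  "diff_op m ([:a, b:] * P) y = a * diff_op m P y + b * diff_op m (pCons 0 P) y"
proof -
  have "[:a, b:] * P = smult a P + smult b (pCons 0 P)" by simp
  then show ?thesis by (simp only: diff_op_add diff_op_smult)
qed

lemma shift_op_diff_op:
  assumes "\<And>y. y > 0 \<Longrightarrow> f y = diff_op m P y" and "degree P < (\<Sum>h=1..q. m h)" and "y > 0"
  shows "shift_op c f y = diff_op m ([:c, -1:] * P) y"
proof -
  have "deriv f y = deriv (diff_op m P) y"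
    by (rule deriv_cong_pos(1)[OF assms(1,3)])
  also have "\<dots> = diff_op m (pCons 0 P) y"
    by (rule DERIV_imp_deriv[OF diff_op_has_derivative[OF assms(2,3)]])
  finally show ?thesis
    unfolding diff_op_linear_factor by (simp add: shift_op_def assms)
qed

lemma shift_op_power_diff_op:
  assumes "\<And>y. y > 0 \<Longrightarrow> f y = diff_op m P y" and "degree P + n \<le> (\<Sum>h=1..q. m h)" and "y > 0"
  shows "(shift_op c ^^ n) f y = diff_op m ([:c, -1:] ^ n * P) y"
  using assms(2,3)
proof (induction n arbitrary: y)
  case (Suc n)
  have "degree ([:c, -1:] ^ n * P) < (\<Sum>h=1..q. m h)"
    using Suc.prems degree_mult_le[of "[:c, -1:] ^ n" P] by simp
  then show ?case
    using Suc by (simp add: shift_op_diff_op[where P = "[:c, -1:] ^ n * P"] mult.assoc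
        del: mult_pCons_left)
qed (simp add: assms)

lemma foldr_shift_op_diff_op:
  assumes "(\<Sum>i\<leftarrow>xs. n i) \<le> (\<Sum>h=1..q. m h)" and "y > 0"
  shows "foldr (\<lambda>i. shift_op (\<xi> i) ^^ n i) xs (T m) y =
    diff_op m (\<Prod>i\<leftarrow>xs. [:\<xi> i, -1:] ^ n i) y"
  using assms
proof (induction xs arbitrary: y)
  case Nil
  have "diff_op m 1 y = T m y"
    unfolding diff_op_def by (subst sum.remove[of _ 0]) (auto simp: coeff_1)
  then show ?case by simp
next
  case (Cons a xs)
  have "degree (\<Prod>i\<leftarrow>xs. [:\<xi> i, -1:] ^ n i) \<le> (\<Sum>i\<leftarrow>xs. n i)"
  proof (induction xs)
    case (Cons b xs)
    then show ?case
      using degree_mult_le[of "[:\<xi> b, -1:] ^ n b" "\<Prod>i\<leftarrow>xs. [:\<xi> i, -1:] ^ n i"] by simp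
  qed simp
  then show ?case
    using Cons by (simp add: shift_op_power_diff_op[where P = "\<Prod>i\<leftarrow>xs. [:\<xi> i, -1:] ^ n i"])
qed

text \<open>The transform of \<open>T l\<close> divided by \<open>G m\<close>. The subtraction is
  truncated, so this reading requires \<open>l h \<le> m h\<close> for all \<open>h\<close>.\<close>

definition symbol :: "(nat \<Rightarrow> nat) \<Rightarrow> (nat \<Rightarrow> nat) \<Rightarrow> real poly" where
  "symbol m l = (\<Prod>h=1..q. [:\<rho> h, 1:] ^ (m h - l h))"

lemma degree_symbol: "degree (symbol m l) = (\<Sum>h=1..q. m h - l h)"
  unfolding symbol_def by (rule degree_prod_linear_powers)

lemma symbol_remove:
  "h \<in> {1..q} \<Longrightarrow>
    symbol m l = [:\<rho> h, 1:] ^ (m h - l h) * (\<Prod>k\<in>{1..q} - {h}. [:\<rho> k, 1:] ^ (m k - l k))"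
  unfolding symbol_def by (rule prod.remove) auto

lemma symbol_bump:
  assumes "h \<in> {1..q}" and "l h < m h"
  shows "symbol m l = [:\<rho> h, 1:] * symbol m (bump l h)"
proof -
  have "m h - l h = Suc (m h - bump l h h)" using assms by simp
  moreover have "(\<Prod>k\<in>{1..q} - {h}. [:\<rho> k, 1:] ^ (m k - bump l h k)) =
      (\<Prod>k\<in>{1..q} - {h}. [:\<rho> k, 1:] ^ (m k - l k))"
    by (intro prod.cong) auto
  ultimately show ?thesis
    unfolding symbol_remove[OF assms(1)] by (simp only: power_Suc mult.assoc)
qed

text \<open>Descent from \<open>m\<close>: the operator \<open>d/dy + \<rho> h\<close> takes
  \<open>T (bump l h)\<close> to \<open>T l\<close>, and correspondingly the symbol gains the factor
  \<open>[:\<rho> h, 1:]\<close>.\<close>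

lemma T_eq_diff_op:
  assumes "\<And>h. h \<in> {1..q} \<Longrightarrow> l h \<le> m h" and "y > 0"
  shows "T l y = diff_op m (symbol m l) y"
  using assms
proof (induction "\<Sum>h=1..q. m h - l h" arbitrary: l y rule: less_induct)
  case less
  show ?case
  proof (cases "\<exists>h\<in>{1..q}. l h < m h")
    case False
    then have "T l = T m" "symbol m l = 1"
      using less.prems(1) by (auto intro!: T_cong simp: symbol_def order.antisym not_less)
    moreover have "diff_op m 1 y = T m y"
      unfolding diff_op_def by (subst sum.remove[of _ 0]) (auto simp: coeff_1)
    ultimately show ?thesis by simp
  next
    case True
    then obtain h where h: "h \<in> {1..q}" "l h < m h" by blast
    let ?l = "bump l h"
    have lt: "(\<Sum>k=1..q. m k - ?l k) < (\<Sum>k=1..q. m k - l k)"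
      using h by (intro sum_strict_mono_ex1) auto
    have le: "?l k \<le> m k" if "k \<in> {1..q}" for k
      using h less.prems(1)[OF that] by auto
    have IH: "T ?l y = diff_op m (symbol m ?l) y" if "y > 0" for y
      using less.hyps[OF lt le that] .
    have "(\<Sum>k=1..q. m k - l k) \<le> (\<Sum>k=1..q. m k)"
      by (intro sum_mono) simp
    then have deg: "degree (symbol m ?l) < (\<Sum>k=1..q. m k)"
      using lt unfolding degree_symbol by linarith
    have "(T ?l has_real_derivative diff_op m (pCons 0 (symbol m ?l)) y) (at y)"
      using diff_op_has_derivative[OF deg less.prems(2)] deriv_cong_pos(2)[OF IH less.prems(2)] by simp
    then have "T l y - \<rho> h * T ?l y = diff_op m (pCons 0 (symbol m ?l)) y"
      using T_has_derivative[OF h(1) less.prems(2), of l] by (rule DERIV_unique[rotated])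
    then show ?thesis
      unfolding symbol_bump[of h l m, OF h] diff_op_linear_factor using IH[OF less.prems(2)] by simp
  qed
qed

section \<open>Laplace transforms and moments\<close>

definition G :: "(nat \<Rightarrow> nat) \<Rightarrow> real \<Rightarrow> real" where
  "G m s = (\<Prod>h=1..q. (s + \<rho> h) powr (- (d h + real (m h))))"

definition region :: "real set" where
  "region = {s. \<forall>h\<in>{1..q}. s + \<rho> h > 0}"

lemma G_pos: "s \<in> region \<Longrightarrow> G m s > 0"
  unfolding G_def region_def by (intro prod_pos) fastforce

lemma T_laplace:
  assumes "\<And>h. h \<in> {1..q} \<Longrightarrow> l h \<le> m h" and s: "s \<in> region"
  shows "has_bochner_integral lborel (\<lambda>y. exp (- s * y) * T l y) (poly (symbol m l) s * G m s)"
proof -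
  have "has_bochner_integral lborel (\<lambda>y. exp (- s * y) * T l y) (G l s)"
  proof (rule has_bochner_integral_nn_integral)
    show "(\<lambda>y. exp (- s * y) * T l y) \<in> borel_measurable lborel"
      using power_kernel_measurable[OF T_power_kernel[of l]] by measurable
    show "(\<integral>\<^sup>+y. ennreal (exp (- s * y) * T l y) \<partial>lborel) = ennreal (G l s)"
      unfolding T_def G_def using q T_pos_exponent s
      by (intro nn_laplace_gamma_conv) (auto simp: region_def)
  qed (use power_kernel_nonneg[OF T_power_kernel[of l]] G_pos[OF s, of l] in auto)
  moreover have "G l s = poly (symbol m l) s * G m s"
    unfolding G_def symbol_def poly_prod prod.distrib[symmetric]
  proof (intro prod.cong refl)
    fix h assume h: "h \<in> {1..q}"
    then have "s + \<rho> h > 0" using s by (auto simp: region_def)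
    then have "(s + \<rho> h) ^ (m h - l h) * (s + \<rho> h) powr (- (d h + real (m h))) =
        (s + \<rho> h) powr (real (m h - l h) + (- (d h + real (m h))))"
      by (simp only: powr_add powr_realpow)
    also have "real (m h - l h) + (- (d h + real (m h))) = - (d h + real (l h))"
      using assms(1)[OF h] by (simp add: of_nat_diff)
    finally show "(s + \<rho> h) powr (- (d h + real (l h))) =
        poly ([:\<rho> h, 1:] ^ (m h - l h)) s * (s + \<rho> h) powr (- (d h + real (m h)))"
      by (simp add: add.commute)
  qed
  ultimately show ?thesis by simp
qed

text \<open>Multiplying a function by \<open>y\<close> turns its transform \<open>P * G m\<close> into \<open>- (P * G m)'\<close>, which equals
  \<open>theta1 m P * G (m + 1)\<close>.\<close>

definition theta1 :: "(nat \<Rightarrow> nat) \<Rightarrow> real poly \<Rightarrow> real poly" where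
  "theta1 m P = (\<Sum>h=1..q. smult (d h + real (m h)) (\<Prod>k\<in>{1..q} - {h}. [:\<rho> k, 1:])) * P
     - pderiv P * (\<Prod>h=1..q. [:\<rho> h, 1:])"

text \<open>Each differentiation, brought to a common denominator, costs one factor
  \<open>s + \<rho> h\<close> for every \<open>h\<close>. After \<open>n\<close> steps the reference
  function is \<open>G (m + n)\<close>, whatever the polynomial.\<close>

fun theta :: "(nat \<Rightarrow> nat) \<Rightarrow> nat \<Rightarrow> real poly \<Rightarrow> real poly" where
  "theta m 0 P = P"
| "theta m (Suc n) P = theta (\<lambda>h. Suc (m h)) n (theta1 m P)"

lemma theta1_add: "theta1 m (P + Q) = theta1 m P + theta1 m Q"
  by (simp add: theta1_def pderiv_add algebra_simps)

lemma theta1_smult: "theta1 m (smult c P) = smult c (theta1 m P)"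
  by (simp add: theta1_def pderiv_smult smult_diff_right)

lemma theta_add: "theta m n (P + Q) = theta m n P + theta m n Q"
  by (induction n arbitrary: m P Q) (auto simp: theta1_add)

lemma theta_smult: "theta m n (smult c P) = smult c (theta m n P)"
  by (induction n arbitrary: m P) (auto simp: theta1_smult)

lemma theta_sum: "theta m n (\<Sum>i\<in>I. P i) = (\<Sum>i\<in>I. theta m n (P i))"
  using theta_smult[of m n 0 0]
  by (induction I rule: infinite_finite_induct) (auto simp: theta_add)

text \<open>The algebraic counterpart of \<open>T_times\<close>: the weight \<open>d h + l h\<close>
  is \<open>d h + m h\<close>, from differentiating \<open>G m\<close>, minus
  \<open>m h - l h\<close>, from differentiating the symbol.\<close>

lemma theta1_symbol:
  assumes "\<And>h. h \<in> {1..q} \<Longrightarrow> l h \<le> m h"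
  shows "theta1 m (symbol m l) =
    (\<Sum>h=1..q. smult (d h + real (l h)) (symbol (\<lambda>h. Suc (m h)) (bump l h)))"
proof -
  let ?x = "\<lambda>h. [:\<rho> h, 1:]"
  define E where "E h = symbol (\<lambda>h. Suc (m h)) (bump l h)" for h
  have E: "E h = ?x h ^ (m h - l h) * ((\<Prod>k\<in>{1..q} - {h}. ?x k ^ (m k - l k)) * (\<Prod>k\<in>{1..q} - {h}. ?x k))"
    if h: "h \<in> {1..q}" for h
  proof -
    have "E h = ?x h ^ (m h - l h) * (\<Prod>k\<in>{1..q} - {h}. ?x k ^ (m k - l k) * ?x k)"
      unfolding E_def symbol_remove[OF h] using assms
      by (intro arg_cong2[where f="(*)"] prod.cong refl)
        (auto simp: Suc_diff_le mult.commute simp del: mult_pCons_left mult_pCons_right)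
    then show ?thesis by (simp only: prod.distrib)
  qed
  have "(\<Prod>k\<in>{1..q} - {h}. ?x k) * symbol m l = E h" if h: "h \<in> {1..q}" for h
    unfolding E[OF h] symbol_def using h
    by (simp only: prod.remove[of "{1..q}" h "\<lambda>k. ?x k ^ (m k - l k)"] finite_atLeastAtMost ac_simps)
  then have 1: "(\<Sum>h=1..q. smult (d h + real (m h)) (\<Prod>k\<in>{1..q} - {h}. ?x k)) * symbol m l =
      (\<Sum>h=1..q. smult (d h + real (m h)) (E h))"
    by (simp add: sum_distrib_right)
  have pd: "pderiv (?x h ^ n) * ?x h = smult (real n) (?x h ^ n)" for h n
  proof (cases n)
    case (Suc k)
    have x: "pderiv (?x h) = 1" by (simp add: pderiv_pCons)
    show ?thesis
      unfolding Suc pderiv_power_Suc x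
      by (simp add: mult.commute del: mult_pCons_left mult_pCons_right)
  qed simp
  have "pderiv (symbol m l) * (\<Prod>h=1..q. ?x h) =
      (\<Sum>h=1..q. (\<Prod>k\<in>{1..q} - {h}. ?x k ^ (m k - l k)) * pderiv (?x h ^ (m h - l h)) * (\<Prod>h=1..q. ?x h))"
    unfolding symbol_def by (subst pderiv_prod) (simp only: sum_distrib_right)
  also have "\<dots> = (\<Sum>h=1..q. smult (real (m h) - real (l h)) (E h))"
  proof (intro sum.cong refl)
    fix h assume h: "h \<in> {1..q}"
    let ?R = "\<Prod>k\<in>{1..q} - {h}. ?x k ^ (m k - l k)" and ?S = "\<Prod>k\<in>{1..q} - {h}. ?x k"
    have "?R * pderiv (?x h ^ (m h - l h)) * (\<Prod>h=1..q. ?x h) =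
      ?R * (pderiv (?x h ^ (m h - l h)) * ?x h) * ?S"
      using h by (simp only: prod.remove[of "{1..q}" h ?x] finite_atLeastAtMost mult.assoc)
    also have "\<dots> = smult (real (m h - l h)) (E h)"
      unfolding pd E[OF h] by (simp only: mult_smult_left mult_smult_right ac_simps)
    finally show "?R * pderiv (?x h ^ (m h - l h)) * (\<Prod>h=1..q. ?x h) = smult (real (m h) - real (l h)) (E h)"
      using assms[OF h] by (simp add: of_nat_diff)
  qed
  finally have 2: "pderiv (symbol m l) * (\<Prod>h=1..q. ?x h) = \<dots>" .
  show ?thesis
    unfolding theta1_def 1 2 E_def[symmetric]
    by (simp add: smult_diff_left[symmetric] flip: sum_subtractf)
qed

text \<open>\<open>theta1\<close> lowers a positive order of vanishing at \<open>\<xi>\<close> by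
  exactly one: the term with \<open>P\<close> keeps the order, while the factor of
  \<open>pderiv P\<close> is nonzero on \<open>region\<close>. The spare exponent \<open>e\<close>
  serves both vanishing (\<open>e = 1\<close>) and nonvanishing (\<open>e = 0\<close>).\<close>

lemma theta_order:
  assumes "\<xi> \<in> region"
  shows "\<exists>R'. theta m n ([:-\<xi>, 1:] ^ (n + e) * R) = [:-\<xi>, 1:] ^ e * R' \<and>
    (poly R \<xi> \<noteq> 0 \<longrightarrow> poly R' \<xi> \<noteq> 0)"
proof (induction n arbitrary: m R)
  case (Suc n)
  let ?x = "[:-\<xi>, 1:]" and ?\<Pi> = "\<Prod>h=1..q. [:\<rho> h, 1:]"
  let ?S = "\<Sum>h=1..q. smult (d h + real (m h)) (\<Prod>k\<in>{1..q} - {h}. [:\<rho> k, 1:])"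
  define R1 where "R1 = ?S * ?x * R - (smult (real (Suc (n + e))) R + ?x * pderiv R) * ?\<Pi>"
  have x: "pderiv ?x = 1" by (simp add: pderiv_pCons)
  have "pderiv (?x ^ Suc (n + e) * R) = ?x ^ (n + e) * (smult (real (Suc (n + e))) R + ?x * pderiv R)"
    unfolding pderiv_mult pderiv_power_Suc x
    by (simp add: algebra_simps del: mult_pCons_left mult_pCons_right)
  then have "theta1 m (?x ^ Suc (n + e) * R) = ?x ^ (n + e) * R1"
    unfolding theta1_def R1_def by (simp add: algebra_simps del: mult_pCons_left mult_pCons_right)
  then have "theta m (Suc n) (?x ^ (Suc n + e) * R) = theta (\<lambda>h. Suc (m h)) n (?x ^ (n + e) * R1)"
    by (simp only: theta.simps add_Suc)
  moreover have "poly R1 \<xi> = - (real (Suc (n + e)) * poly R \<xi> * (\<Prod>h=1..q. \<rho> h + \<xi>))"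
    by (simp add: R1_def poly_prod)
  moreover have "(\<Prod>h=1..q. \<rho> h + \<xi>) \<noteq> 0"
    using assms by (auto simp: region_def add.commute)
  ultimately show ?case
    using Suc.IH[of "\<lambda>h. Suc (m h)" R1] by auto
qed auto

lemma theta_zero:
  assumes "\<xi> \<in> region" and "[:-\<xi>, 1:] ^ Suc n dvd P"
  shows "poly (theta m n P) \<xi> = 0"
proof -
  obtain R where "P = [:-\<xi>, 1:] ^ (n + 1) * R" using assms(2) by auto
  then show ?thesis using theta_order[OF assms(1), of m n 1 R] by auto
qed

lemma theta_nonzero:
  assumes "\<xi> \<in> region" and "poly R \<xi> \<noteq> 0"
  shows "poly (theta m n ([:-\<xi>, 1:] ^ n * R)) \<xi> \<noteq> 0"
  using theta_order[OF assms(1), of m n 0 R] assms(2) by auto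

text \<open>Vanishing moments become Hermite conditions: for \<open>P \<noteq> 0\<close>, the first
  \<open>k\<close> with a nonzero value is the order of \<open>\<xi>\<close> as a root of
  \<open>P\<close>.\<close>

lemma theta_zero_iff_dvd:
  assumes "\<xi> \<in> region"
  shows "(\<forall>k<n. poly (theta m k P) \<xi> = 0) \<longleftrightarrow> [:-\<xi>, 1:] ^ n dvd P"
proof
  assume *: "\<forall>k<n. poly (theta m k P) \<xi> = 0"
  show "[:-\<xi>, 1:] ^ n dvd P"
  proof (rule ccontr)
    assume n: "\<not> [:-\<xi>, 1:] ^ n dvd P"
    then have "P \<noteq> 0" by auto
    then obtain R where R: "P = [:-\<xi>, 1:] ^ order \<xi> P * R" "\<not> [:-\<xi>, 1:] dvd R"
      using order_decomp by blast
    have "order \<xi> P < n" using n \<open>P \<noteq> 0\<close> by (auto simp: order_divides)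
    moreover have "poly (theta m (order \<xi> P) ([:-\<xi>, 1:] ^ order \<xi> P * R)) \<xi> \<noteq> 0"
      using R(2) by (intro theta_nonzero[OF assms]) (auto simp: poly_eq_0_iff_dvd)
    ultimately show False using * R(1) by metis
  qed
next
  assume "[:-\<xi>, 1:] ^ n dvd P"
  then show "\<forall>k<n. poly (theta m k P) \<xi> = 0"
    using theta_zero[OF assms] by (metis Suc_leI dvd_trans le_imp_power_dvd)
qed

text \<open>\<open>f\<close> equals \<open>P(d/dy) (T m)\<close> and has the transform \<open>P * G m\<close>. Both are recorded, which makes
  injectivity of the Laplace transform unnecessary.\<close>

definition represents :: "(nat \<Rightarrow> nat) \<Rightarrow> real poly \<Rightarrow> (real \<Rightarrow> real) \<Rightarrow> bool" where
  "represents m P f \<longleftrightarrow> (\<forall>y>0. f y = diff_op m P y) \<and>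
     (\<forall>n. \<forall>s\<in>region. has_bochner_integral lborel
        (\<lambda>y. indicator {0<..} y * (y ^ n * exp (- s * y) * f y))
        (poly (theta m n P) s * G (\<lambda>h. m h + n) s))"

lemma represents_sum:
  assumes "\<And>i. i \<in> I \<Longrightarrow> represents m (P i) (f i)"
  shows "represents m (\<Sum>i\<in>I. smult (c i) (P i)) (\<lambda>y. \<Sum>i\<in>I. c i * f i y)"
  unfolding represents_def
proof (intro conjI allI ballI impI)
  fix y :: real assume "y > 0"
  then show "(\<Sum>i\<in>I. c i * f i y) = diff_op m (\<Sum>i\<in>I. smult (c i) (P i)) y"
    using assms by (simp add: diff_op_sum diff_op_smult represents_def)
next
  fix n s assume s: "s \<in> region"
  have "has_bochner_integral lborel
        (\<lambda>y. \<Sum>i\<in>I. c i * (indicator {0<..} y * (y ^ n * exp (- s * y) * f i y)))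
        (\<Sum>i\<in>I. c i * (poly (theta m n (P i)) s * G (\<lambda>h. m h + n) s))"
    using assms s by (intro has_bochner_integral_sum has_bochner_integral_mult_right)
      (auto simp: represents_def)
  then show "has_bochner_integral lborel
        (\<lambda>y. indicator {0<..} y * (y ^ n * exp (- s * y) * (\<Sum>i\<in>I. c i * f i y)))
        (poly (theta m n (\<Sum>i\<in>I. smult (c i) (P i))) s * G (\<lambda>h. m h + n) s)"
    by (simp add: theta_sum theta_smult poly_sum sum_distrib_left sum_distrib_right ac_simps)
qed

text \<open>The induction varies \<open>m\<close> and \<open>l\<close> together: a factor
  \<open>y\<close> is traded for a bump of \<open>l\<close>, and passing to \<open>m + 1\<close>
  keeps \<open>l\<close> below the reference index.\<close>

lemma T_moments:
  assumes "\<And>h. h \<in> {1..q} \<Longrightarrow> l h \<le> m h" and "s \<in> region"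
  shows "has_bochner_integral lborel (\<lambda>y. y ^ n * exp (- s * y) * T l y)
    (poly (theta m n (symbol m l)) s * G (\<lambda>h. m h + n) s)"
  using assms(1)
proof (induction n arbitrary: m l)
  case 0
  then show ?case using T_laplace[OF _ assms(2), of l m] by simp
next
  case (Suc n)
  have "has_bochner_integral lborel (\<lambda>y. \<Sum>h=1..q. (d h + real (l h)) * (y ^ n * exp (- s * y) * T (bump l h) y))
    (\<Sum>h=1..q. (d h + real (l h)) * (poly (theta (\<lambda>h. Suc (m h)) n (symbol (\<lambda>h. Suc (m h)) (bump l h))) s
      * G (\<lambda>h. Suc (m h) + n) s))"
    using Suc.prems by (intro has_bochner_integral_sum has_bochner_integral_mult_right Suc.IH) (auto simp: le_SucI)
  moreover have "(\<lambda>y. \<Sum>h=1..q. (d h + real (l h)) * (y ^ n * exp (- s * y) * T (bump l h) y)) =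
      (\<lambda>y. y ^ Suc n * exp (- s * y) * T l y)"
  proof
    fix y
    have "y ^ Suc n * exp (- s * y) * T l y = y ^ n * exp (- s * y) * (y * T l y)" by simp
    then show "(\<Sum>h=1..q. (d h + real (l h)) * (y ^ n * exp (- s * y) * T (bump l h) y)) =
        y ^ Suc n * exp (- s * y) * T l y"
      unfolding T_times by (simp add: sum_distrib_left ac_simps)
  qed
  moreover have th: "theta1 m (symbol m l) =
      (\<Sum>h=1..q. smult (d h + real (l h)) (symbol (\<lambda>h. Suc (m h)) (bump l h)))"
    using Suc.prems by (rule theta1_symbol)
  moreover have "(\<Sum>h=1..q. (d h + real (l h)) * (poly (theta (\<lambda>h. Suc (m h)) n (symbol (\<lambda>h. Suc (m h)) (bump l h))) s
      * G (\<lambda>h. Suc (m h) + n) s)) = poly (theta m (Suc n) (symbol m l)) s * G (\<lambda>h. m h + Suc n) s"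
    by (simp add: th theta_sum theta_smult poly_sum sum_distrib_right mult.assoc)
  ultimately show ?case by simp
qed

lemma represents_T:
  assumes "\<And>h. h \<in> {1..q} \<Longrightarrow> l h \<le> m h"
  shows "represents m (symbol m l) (T l)"
proof -
  have "(\<lambda>y. indicator {0<..} y * (y ^ n * exp (- s * y) * T l y)) =
      (\<lambda>y. y ^ n * exp (- s * y) * T l y)" for n s
    using power_kernel_nonpos[OF T_power_kernel[of l]] by (auto simp: fun_eq_iff indicator_def)
  then show ?thesis
    unfolding represents_def using T_moments[OF assms] T_eq_diff_op[OF assms] by auto
qed

end

section \<open>The polynomials representing the row functions\<close>

context gamma_system
begin

text \<open>In contrast to \<open>theta\<close>, the reference \<open>G m\<close> stays fixed: each
  factor \<open>y\<close> is paid for by raising \<open>l\<close>, so the degree falls instead of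
  the index growing.\<close>

fun times_symbol :: "(nat \<Rightarrow> nat) \<Rightarrow> nat \<Rightarrow> (nat \<Rightarrow> nat) \<Rightarrow> real poly" where
  "times_symbol m 0 l = symbol m l"
| "times_symbol m (Suc k) l = (\<Sum>h=1..q. smult (d h + real (l h)) (times_symbol m k (bump l h)))"

lemma represents_times:
  assumes "\<And>h. h \<in> {1..q} \<Longrightarrow> l h + k \<le> m h"
  shows "represents m (times_symbol m k l) (\<lambda>y. y ^ k * T l y)"
  using assms
proof (induction k arbitrary: l)
  case 0
  then show ?case using represents_T[of l m] by simp
next
  case (Suc k)
  have "represents m (\<Sum>h=1..q. smult (d h + real (l h)) (times_symbol m k (bump l h)))
      (\<lambda>y. \<Sum>h=1..q. (d h + real (l h)) * (y ^ k * T (bump l h) y))"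
  proof (intro represents_sum Suc.IH)
    fix h k' assume "k' \<in> {1..q}"
    then show "bump l h k' + k \<le> m k'" using Suc.prems[of k'] by auto
  qed
  moreover have "(\<lambda>y. \<Sum>h=1..q. (d h + real (l h)) * (y ^ k * T (bump l h) y)) =
      (\<lambda>y. y ^ Suc k * T l y)"
  proof
    fix y
    have "y ^ Suc k * T l y = y ^ k * (y * T l y)" by simp
    then show "(\<Sum>h=1..q. (d h + real (l h)) * (y ^ k * T (bump l h) y)) = y ^ Suc k * T l y"
      unfolding T_times by (simp add: sum_distrib_left ac_simps)
  qed
  ultimately show ?case by simp
qed

lemma degree_times_symbol:
  assumes "\<And>h. h \<in> {1..q} \<Longrightarrow> l h + k \<le> m h"
  shows "degree (times_symbol m k l) \<le> (\<Sum>h=1..q. m h) - (\<Sum>h=1..q. l h) - k"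
  using assms
proof (induction k arbitrary: l)
  case 0
  then show ?case
    using sum_subtractf_nat[of "{1..q}" l m] by (simp add: degree_symbol)
next
  case (Suc k)
  have "degree (smult (d h + real (l h)) (times_symbol m k (bump l h)))
      \<le> (\<Sum>h=1..q. m h) - (\<Sum>h=1..q. l h) - Suc k" if h: "h \<in> {1..q}" for h
  proof -
    have "(\<Sum>k\<in>{1..q} - {h}. bump l h k) = (\<Sum>k\<in>{1..q} - {h}. l k)"
      by (intro sum.cong) auto
    then have "(\<Sum>k=1..q. bump l h k) = Suc (\<Sum>k=1..q. l k)"
      using h sum.remove[of "{1..q}" h l] sum.remove[of "{1..q}" h "bump l h"] by simp
    moreover have "bump l h k' + k \<le> m k'" if "k' \<in> {1..q}" for k'
      using Suc.prems[OF that] by auto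
    ultimately have "degree (times_symbol m k (bump l h)) \<le> (\<Sum>h=1..q. m h) - Suc (\<Sum>h=1..q. l h) - k"
      using Suc.IH[of "bump l h"] by (simp del: fun_upd_apply)
    then show ?thesis
      using degree_smult_le[of "d h + real (l h)" "times_symbol m k (bump l h)"] by linarith
  qed
  then show ?case
    unfolding times_symbol.simps by (rule degree_sum_le[OF finite_atLeastAtMost])
qed

lemma times_symbol_dvd:
  assumes j: "j \<in> {1..q}" and "\<And>h. h \<in> {1..q} \<Longrightarrow> l h + k \<le> m h"
    and "e \<le> m j - l j - k"
  shows "[:\<rho> j, 1:] ^ e dvd times_symbol m k l"
  using assms(2,3)
proof (induction k arbitrary: l)
  case 0
  then show ?case
    by (simp add: symbol_remove[OF j] dvd_mult2 le_imp_power_dvd)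
next
  case (Suc k)
  have "[:\<rho> j, 1:] ^ e dvd times_symbol m k (bump l h)" for h
  proof (rule Suc.IH)
    show "bump l h h' + k \<le> m h'" if "h' \<in> {1..q}" for h'
      using Suc.prems(1)[OF that] by auto
  qed (use Suc.prems(2) in auto)
  then show ?case by (auto intro!: dvd_sum dvd_smult)
qed

text \<open>Only the term with all \<open>k\<close> increments at \<open>j\<close> attains the
  exponent \<open>m j - l j - k\<close>. Its weight is a product of positive numbers, and its other
  factors do not vanish at \<open>- \<rho> j\<close>; every other term contains at least one more
  factor \<open>[:\<rho> j, 1:]\<close>.\<close>

lemma times_symbol_not_dvd:
  assumes j: "j \<in> {1..q}" and "\<And>h. h \<in> {1..q} \<Longrightarrow> l h + k \<le> m h"
    and distinct: "\<And>h. h \<in> {1..q} \<Longrightarrow> h \<noteq> j \<Longrightarrow> m h > 0 \<Longrightarrow> \<rho> h \<noteq> \<rho> j"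
  shows "\<not> [:\<rho> j, 1:] ^ Suc (m j - l j - k) dvd times_symbol m k l"
  using assms(2)
proof (induction k arbitrary: l)
  case 0
  let ?R = "\<Prod>k\<in>{1..q} - {j}. [:\<rho> k, 1:] ^ (m k - l k)"
  have "\<not> [:\<rho> j, 1:] dvd ?R"
  proof
    assume "[:\<rho> j, 1:] dvd ?R"
    then have "poly ?R (- \<rho> j) = 0" using poly_eq_0_iff_dvd[of ?R "- \<rho> j"] by simp
    then obtain h where "h \<in> {1..q} - {j}" "poly ([:\<rho> h, 1:] ^ (m h - l h)) (- \<rho> j) = 0"
      unfolding poly_prod by (metis (no_types, lifting) finite_Diff finite_atLeastAtMost prod_zero_iff)
    then show False using distinct[of h] by auto
  qed
  then show ?case
    by (simp add: symbol_remove[OF j] mult.commute[of "[:\<rho> j, 1:]"]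
        del: mult_pCons_left mult_pCons_right)
next
  case (Suc k)
  let ?t = "\<lambda>h. smult (d h + real (l h)) (times_symbol m k (bump l h))"
  have le: "bump l h h' + k \<le> m h'" if "h' \<in> {1..q}" for h h'
    using Suc.prems[OF that] by auto
  have e: "Suc (m j - l j - Suc k) = m j - l j - k"
    using Suc.prems[OF j] by simp
  have "[:\<rho> j, 1:] ^ (m j - l j - k) dvd ?t h" if "h \<noteq> j" for h
    using that by (intro dvd_smult times_symbol_dvd[OF j le]) auto
  then have "[:\<rho> j, 1:] ^ (m j - l j - k) dvd (\<Sum>h\<in>{1..q} - {j}. ?t h)"
    by (intro dvd_sum) auto
  moreover have "\<not> [:\<rho> j, 1:] ^ (m j - l j - k) dvd ?t j"
  proof -
    have "\<not> [:\<rho> j, 1:] ^ Suc (m j - bump l j j - k) dvd times_symbol m k (bump l j)"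
      by (rule Suc.IH[OF le])
    moreover have "Suc (m j - bump l j j - k) = m j - l j - k"
      using Suc.prems[OF j] by simp
    ultimately have "\<not> [:\<rho> j, 1:] ^ (m j - l j - k) dvd times_symbol m k (bump l j)"
      by metis
    then show ?thesis
      using T_pos_exponent[OF j, of l] by (simp add: dvd_smult_iff)
  qed
  ultimately have "\<not> [:\<rho> j, 1:] ^ (m j - l j - k) dvd (\<Sum>h=1..q. ?t h)"
    using j by (subst sum.remove[of _ j]) (auto simp: dvd_add_left_iff)
  then show ?case unfolding e by simp
qed

end

locale near_diagonal = gamma_system +
  fixes m :: "nat \<Rightarrow> nat"
  assumes near: "i \<in> {1..q} \<Longrightarrow> j \<in> {1..q} \<Longrightarrow> m i \<le> Suc (m j)"
    and rates: "inj_on \<rho> {h \<in> {1..q}. m h > 0}"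
begin

definition N :: nat where "N = (\<Sum>j=1..q. m j)"

definition slot_symbol :: "nat \<times> nat \<Rightarrow> real poly" where
  "slot_symbol = (\<lambda>(j, k). times_symbol m k (unit_index j))"

definition vec_symbol :: "(nat \<Rightarrow> real poly) \<Rightarrow> real poly" where
  "vec_symbol B = (\<Sum>(j, k)\<in>slots q m. smult (coeff (B j) k) (slot_symbol (j, k)))"

text \<open>Near-diagonality enters here: for \<open>h \<noteq> j\<close> the claim is
  \<open>k \<le> m h\<close>, and \<open>k < m j \<le> m h + 1\<close>.\<close>

lemma slot_le: "(j, k) \<in> slots q m \<Longrightarrow> h \<in> {1..q} \<Longrightarrow> unit_index j h + k \<le> m h"
  using near[of j h] by (auto simp: unit_index_def)

lemma represents_slot:
  assumes "(j, k) \<in> slots q m"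
  shows "represents m (slot_symbol (j, k)) (\<lambda>y. y ^ k * F_fun q \<rho> d j y)"
  unfolding slot_symbol_def F_fun_eq_T prod.case
  by (rule represents_times[OF slot_le[OF assms]])

lemma card_slots: "card (slots q m) = N"
  by (simp add: N_def)

lemma slot_symbol_coeff:
  assumes "i \<in> slots q m" and "r \<ge> N" shows "coeff (slot_symbol i) r = 0"
proof -
  obtain j k where i: "i = (j, k)" by force
  have "(\<Sum>h=1..q. unit_index j h) = 1"
    using assms by (simp add: i unit_index_def)
  then have "degree (slot_symbol i) \<le> N - 1 - k"
    using degree_times_symbol[OF slot_le] assms(1) unfolding N_def i slot_symbol_def by force
  moreover have "N > 0"
    using assms(1) unfolding card_slots[symmetric] card_gt_0_iff by blast
  ultimately show ?thesis
    using assms(2) by (intro coeff_eq_0) simp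
qed

lemma vec_symbol_coeff: "r \<ge> N \<Longrightarrow> coeff (vec_symbol B) r = 0"
  unfolding vec_symbol_def
  by (auto simp: coeff_sum slot_symbol_coeff intro!: sum.neutral)

text \<open>Among the slots with nonzero weight, choose \<open>(j, k)\<close> with the largest
  \<open>k\<close>. Its symbol has order exactly \<open>m j - 1 - k\<close> at
  \<open>- \<rho> j\<close>. Any other such slot \<open>(j', k')\<close> has order at least
  \<open>m j - k\<close>: for \<open>j' \<noteq> j\<close> because \<open>unit_index j'\<close>
  spends nothing on \<open>j\<close>, for \<open>j' = j\<close> because then
  \<open>k' < k\<close>.\<close>

lemma slot_symbols_independent:
  assumes "(\<Sum>i\<in>slots q m. smult (c i) (slot_symbol i)) = 0"
  shows "\<forall>i\<in>slots q m. c i = 0"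
proof (rule ccontr)
  let ?S = "{i \<in> slots q m. c i \<noteq> 0}"
  assume "\<not> ?thesis"
  then have "?S \<noteq> {}" "finite ?S" by auto
  then have "Max (snd ` ?S) \<in> snd ` ?S" by (intro Max_in) blast+
  then obtain i where i: "i \<in> ?S" "Max (snd ` ?S) = snd i" by blast
  have max: "snd i' \<le> snd i" if "i' \<in> ?S" for i'
    unfolding i(2)[symmetric] using that \<open>finite ?S\<close> by (intro Max_ge) blast+
  obtain j k where jk: "i = (j, k)" by force
  then have j: "j \<in> {1..q}" "k < m j" "c (j, k) \<noteq> 0" using i(1) by auto
  define e where "e = m j - k"
  have rest: "[:\<rho> j, 1:] ^ e dvd smult (c i') (slot_symbol i')"
    if "i' \<in> slots q m - {i}" for i'
  proof (cases "c i' = 0")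
    case False
    obtain j' k' where jk': "i' = (j', k')" by force
    then have "k' \<le> k" using max[of i'] that False jk by auto
    moreover have "unit_index j' j + k' \<le> m j" using slot_le[of j' k' j] that jk' j by auto
    moreover have "unit_index j' j \<le> 1" "unit_index j' j = 0 \<or> j' = j" by (auto simp: unit_index_def)
    moreover have "j' \<noteq> j \<or> k' \<noteq> k" using that jk jk' by auto
    ultimately have "e \<le> m j - unit_index j' j - k'" unfolding e_def by linarith
    then show ?thesis
      unfolding jk' slot_symbol_def prod.case using that jk'
      by (intro dvd_smult times_symbol_dvd j(1) slot_le) auto
  qed simp
  have "\<not> [:\<rho> j, 1:] ^ Suc (m j - unit_index j j - k) dvd slot_symbol i"
    unfolding jk slot_symbol_def prod.case
  proof (rule times_symbol_not_dvd[OF j(1) slot_le])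
    fix h assume "h \<in> {1..q}" "h \<noteq> j" "m h > 0"
    then show "\<rho> h \<noteq> \<rho> j" using j inj_onD[OF rates, of h j] by auto
  qed (use i(1) jk in auto)
  moreover have "Suc (m j - unit_index j j - k) = e"
    using j by (simp add: e_def unit_index_def)
  ultimately have "\<not> [:\<rho> j, 1:] ^ e dvd slot_symbol i"
    by metis
  then have "\<not> [:\<rho> j, 1:] ^ e dvd smult (c i) (slot_symbol i)"
    using j(3) jk by (simp add: dvd_smult_iff)
  moreover have "[:\<rho> j, 1:] ^ e dvd (\<Sum>i\<in>slots q m - {i}. smult (c i) (slot_symbol i))"
    using rest by (intro dvd_sum) auto
  ultimately have "\<not> [:\<rho> j, 1:] ^ e dvd (\<Sum>i\<in>slots q m. smult (c i) (slot_symbol i))"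
    using i(1) by (subst sum.remove[of _ i]) (auto simp: dvd_add_left_iff)
  then show False unfolding assms by simp
qed

lemma slot_symbols_span:
  assumes "\<And>r. r \<ge> N \<Longrightarrow> coeff P r = 0"
  shows "\<exists>c. P = (\<Sum>i\<in>slots q m. smult (c i) (slot_symbol i))"
  by (rule poly_family_spans[OF _ card_slots slot_symbol_coeff slot_symbols_independent assms]) auto

lemma vec_symbol_eq: "vec_symbol B = (\<Sum>i\<in>slots q m. smult (coeff (B (fst i)) (snd i)) (slot_symbol i))"
  unfolding vec_symbol_def by (intro sum.cong) auto

lemma vec_symbol_surj:
  assumes "\<And>r. r \<ge> N \<Longrightarrow> coeff P r = 0"
  shows "\<exists>B\<in>poly_vectors q m. vec_symbol B = P"
proof -
  obtain c where c: "P = (\<Sum>i\<in>slots q m. smult (c i) (slot_symbol i))"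
    using slot_symbols_span[OF assms] by blast
  have "vec_symbol (coeff_vec q m c) = P"
    unfolding vec_symbol_eq c by (intro sum.cong) (auto simp: coeff_coeff_vec)
  then show ?thesis using coeff_vec_in_poly_vectors by blast
qed

lemma vec_symbol_eq_0:
  assumes "B \<in> poly_vectors q m" and "vec_symbol B = 0" shows "B = 0"
  using slot_symbols_independent[OF assms(2)[unfolded vec_symbol_eq]]
  by (intro poly_vectors_eq_0I[OF assms(1)]) force

lemma vec_symbol_diff_scale: "vec_symbol (A - scale_vec c B) = vec_symbol A - smult c (vec_symbol B)"
  by (simp add: vec_symbol_eq scale_vec_def smult_diff_left sum_subtractf smult_sum_right)

lemma vec_symbol_inj:
  assumes "A \<in> poly_vectors q m" "B \<in> poly_vectors q m" "vec_symbol A = vec_symbol B"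
  shows "A = B"
proof -
  have "A - scale_vec 1 B = 0"
    using assms by (intro vec_symbol_eq_0 poly_vectors_lincomb) (simp_all add: vec_symbol_diff_scale)
  then show ?thesis by (simp add: scale_vec_def)
qed

lemma represents_B_form:
  assumes "B \<in> poly_vectors q m"
  shows "represents m (vec_symbol B) (B_form q \<rho> d B)"
proof -
  have "B_form q \<rho> d B y = (\<Sum>j=1..q. \<Sum>k<m j. coeff (B j) k * (y ^ k * F_fun q \<rho> d j y))" for y
    unfolding B_form_def
    by (intro sum.cong) (simp_all add: poly_vectors_poly[OF assms] sum_distrib_right mult.assoc)
  also have "(\<Sum>j=1..q. \<Sum>k<m j. coeff (B j) k * (y ^ k * F_fun q \<rho> d j y)) =
      (\<Sum>i\<in>slots q m. coeff (B (fst i)) (snd i) * (y ^ snd i * F_fun q \<rho> d (fst i) y))" for y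
    by (subst sum.Sigma) (auto simp: case_prod_beta)
  finally have "B_form q \<rho> d B =
      (\<lambda>y. \<Sum>i\<in>slots q m. coeff (B (fst i)) (snd i) * (y ^ snd i * F_fun q \<rho> d (fst i) y))"
    by blast
  then show ?thesis
    unfolding vec_symbol_eq using represents_slot
    by (auto intro!: represents_sum)
qed

text \<open>A zero form has zero transform, so its symbol times the positive \<open>G m\<close>
  vanishes at every \<open>s > 0\<close>; a polynomial with infinitely many roots is zero, and the
  slot symbols are independent.\<close>

lemma B_form_nonzero:
  assumes B: "B \<in> poly_vectors q m" and zero: "\<And>y. y > 0 \<Longrightarrow> B_form q \<rho> d B y = 0"
  shows "B = 0"
proof (rule vec_symbol_eq_0[OF B], rule ccontr)
  assume nz: "vec_symbol B \<noteq> 0"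
  have "poly (vec_symbol B) s = 0" if s: "s > 0" for s
  proof -
    have reg: "s \<in> region" using s \<rho>_pos by (auto simp: region_def intro: add_pos_pos)
    have "has_bochner_integral lborel (\<lambda>y. indicator {0<..} y * (y ^ 0 * exp (- s * y) * B_form q \<rho> d B y))
        (poly (theta m 0 (vec_symbol B)) s * G (\<lambda>h. m h + 0) s)"
      using represents_B_form[OF B] reg unfolding represents_def by blast
    moreover have "(\<lambda>y. indicator {0<..} y * (y ^ 0 * exp (- s * y) * B_form q \<rho> d B y)) = (\<lambda>_. 0)"
      using zero by (auto simp: fun_eq_iff indicator_def)
    ultimately have "poly (theta m 0 (vec_symbol B)) s * G (\<lambda>h. m h + 0) s = 0"
      by (simp add: has_bochner_integral_iff)
    then show ?thesis using G_pos[OF reg, of m] by simp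
  qed
  then have "{0<..} \<subseteq> {s. poly (vec_symbol B) s = 0}" by auto
  then have "finite {0::real<..}"
    using poly_roots_finite[OF nz] finite_subset by blast
  then show False by (simp add: infinite_Ioi)
qed

lemma B_form_inj:
  assumes "A \<in> poly_vectors q m" "B \<in> poly_vectors q m"
    and "\<And>y. y > 0 \<Longrightarrow> B_form q \<rho> d A y = B_form q \<rho> d B y"
  shows "A = B"
proof -
  have "A - scale_vec 1 B = 0"
    using assms by (intro B_form_nonzero poly_vectors_lincomb)
      (simp_all add: B_form_def scale_vec_def left_diff_distrib sum_subtractf)
  then show ?thesis by (simp add: scale_vec_def)
qed

end

section \<open>The two problems\<close>

lemma vanishing_integral_iff:
  "has_bochner_integral lborel (\<lambda>y. indicator {0<..} y * f y) v \<Longrightarrow> vanishing_integral f \<longleftrightarrow> v = 0"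
  by (simp add: vanishing_integral_def set_integrable_def set_lebesgue_integral_def has_bochner_integral_iff)

locale column_nodes = near_diagonal +
  fixes p :: nat and \<xi> :: "nat \<Rightarrow> real" and n :: "nat \<Rightarrow> nat"
  assumes nodes: "i \<in> {1..p} \<Longrightarrow> \<xi> i \<in> region"
    and distinct_nodes: "inj_on \<xi> {i \<in> {1..p}. n i > 0}"
begin

section \<open>The A-problem as annihilation of polynomials by a functional\<close>

text \<open>For a slot \<open>(i, k)\<close>: the half-line integral of
  \<open>y ^ k * exp (- \<xi> i * y)\<close> against any function represented by
  \<open>P\<close>.\<close>

definition node_functional :: "nat \<times> nat \<Rightarrow> real poly \<Rightarrow> real" where
  "node_functional i P = poly (theta m (snd i) P) (\<xi> (fst i)) * G (\<lambda>h. m h + snd i) (\<xi> (fst i))"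

definition functional :: "(nat \<Rightarrow> real poly) \<Rightarrow> real poly \<Rightarrow> real" where
  "functional A P = (\<Sum>i\<in>slots p n. coeff (A (fst i)) (snd i) * node_functional i P)"

lemma node_functional_sum:
  "node_functional i (\<Sum>j\<in>J. smult (c j) (P j)) = (\<Sum>j\<in>J. c j * node_functional i (P j))"
  by (simp add: node_functional_def theta_sum theta_smult poly_sum sum_distrib_right mult.assoc)

lemma functional_sum:
  "functional A (\<Sum>j\<in>J. smult (c j) (P j)) = (\<Sum>j\<in>J. c j * functional A (P j))"
  unfolding functional_def node_functional_sum sum_distrib_left
  by (subst sum.swap) (simp add: ac_simps)

lemma functional_diff_scale: "functional (A - scale_vec c B) P = functional A P - c * functional B P"
  by (simp add: functional_def scale_vec_def left_diff_distrib sum_subtractf sum_distrib_left mult.assoc)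

lemma functional_scale: "functional (scale_vec c B) P = c * functional B P"
  by (simp add: functional_def scale_vec_def sum_distrib_left mult.assoc)

lemma A_form_integral:
  assumes A: "A \<in> poly_vectors p n" and f: "represents m P f"
  shows "has_bochner_integral lborel (\<lambda>y. indicator {0<..} y * (f y * A_form p \<xi> A y)) (functional A P)"
proof -
  have "A_form p \<xi> A y = (\<Sum>i=1..p. \<Sum>k<n i. coeff (A i) k * (y ^ k * exp (- \<xi> i * y)))" for y
    unfolding A_form_def
    by (intro sum.cong) (simp_all add: poly_vectors_poly[OF A] sum_distrib_right mult.assoc)
  also have "(\<Sum>i=1..p. \<Sum>k<n i. coeff (A i) k * (y ^ k * exp (- \<xi> i * y))) =
      (\<Sum>i\<in>slots p n. coeff (A (fst i)) (snd i) * (y ^ snd i * exp (- \<xi> (fst i) * y)))" for y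
    by (subst sum.Sigma) (auto simp: case_prod_beta)
  finally have eq: "(\<lambda>y. indicator {0<..} y * (f y * A_form p \<xi> A y)) =
     (\<lambda>y. \<Sum>i\<in>slots p n. coeff (A (fst i)) (snd i) *
       (indicator {0<..} y * (y ^ snd i * exp (- \<xi> (fst i) * y) * f y)))"
    by (simp add: fun_eq_iff sum_distrib_left ac_simps)
  show ?thesis
    unfolding eq functional_def node_functional_def using f nodes
    by (intro has_bochner_integral_sum has_bochner_integral_mult_right) (auto simp: represents_def)
qed

text \<open>The slot symbols span the polynomials of degree less than \<open>N\<close>, so the
  conditions concern that whole space and the row functions disappear from the problem.\<close>

lemma A_solutions_iff:
  "A \<in> A_solutions p q \<rho> d \<xi> n m \<longleftrightarrow>
     A \<in> poly_vectors p n \<and> (\<forall>P. (\<forall>r\<ge>N. coeff P r = 0) \<longrightarrow> functional A P = 0)"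
proof (cases "A \<in> poly_vectors p n")
  case A: True
  have "vanishing_integral (\<lambda>y. y ^ k * F_fun q \<rho> d j y * A_form p \<xi> A y) \<longleftrightarrow>
      functional A (slot_symbol (j, k)) = 0" if "(j, k) \<in> slots q m" for j k
    by (rule vanishing_integral_iff[OF A_form_integral[OF A represents_slot[OF that]]])
  then have "A \<in> A_solutions p q \<rho> d \<xi> n m \<longleftrightarrow>
      (\<forall>i\<in>slots q m. functional A (slot_symbol i) = 0)"
    using A by (auto simp: A_solutions_def)
  also have "\<dots> \<longleftrightarrow> (\<forall>P. (\<forall>r\<ge>N. coeff P r = 0) \<longrightarrow> functional A P = 0)"
  proof (intro iffI allI impI ballI)
    fix P :: "real poly" assume *: "\<forall>i\<in>slots q m. functional A (slot_symbol i) = 0" "\<forall>r\<ge>N. coeff P r = 0"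
    then obtain c where "P = (\<Sum>i\<in>slots q m. smult (c i) (slot_symbol i))"
      using slot_symbols_span by blast
    then have "functional A P = (\<Sum>i\<in>slots q m. c i * functional A (slot_symbol i))"
      by (simp only: functional_sum)
    also have "\<dots> = 0" using *(1) by (intro sum.neutral) auto
    finally show "functional A P = 0" .
  qed (use slot_symbol_coeff in blast)
  finally show ?thesis using A by simp
qed (simp add: A_solutions_def)

text \<open>If \<open>A t\<close> is a nonzero component of degree \<open>e\<close>, the functional of \<open>A\<close> is tested on the product of
  \<open>(s - \<xi> t) ^ e\<close> with the powers belonging to the other nodes, the one at \<open>i\<close> reduced by one: only
  the top coefficient of \<open>A t\<close> survives.\<close>

lemma A_solution_eq_0:
  assumes A: "A \<in> A_solutions p q \<rho> d \<xi> n m" and n: "(\<Sum>i=1..p. n i) = N + 1"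
    and i: "i \<in> {1..p}" "n i > 0" "coeff (A i) (n i - 1) = 0"
  shows "A = 0"
proof (rule ccontr)
  have pv: "A \<in> poly_vectors p n" using A by (simp add: A_solutions_def)
  assume "A \<noteq> 0"
  then obtain t where t: "A t \<noteq> 0" by (auto simp: fun_eq_iff)
  then have t1: "t \<in> {1..p}" "degree (A t) < n t"
    using pv by (auto simp: poly_vectors_def)
  define e where "e = degree (A t)"
  define n' where "n' = n(i := n i - 1)"
  define R where "R = (\<Prod>k\<in>{1..p} - {t}. [:- \<xi> k, 1:] ^ n' k)"
  let ?P = "[:- \<xi> t, 1:] ^ e * R"
  have "e \<le> n' t"
  proof (cases "t = i")
    case True
    have "coeff (A t) e \<noteq> 0" using t by (simp add: e_def)
    then show ?thesis using True i(3) t1(2) by (cases "e = n i - 1") (auto simp: n'_def e_def)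
  next
    case False
    then show ?thesis using t1 by (simp add: n'_def e_def)
  qed
  moreover have "(\<Sum>k=1..p. n' k) = N"
  proof -
    have "(\<Sum>k\<in>{1..p} - {i}. n' k) = (\<Sum>k\<in>{1..p} - {i}. n k)"
      by (intro sum.cong) (auto simp: n'_def)
    then show ?thesis
      using n i sum.remove[of "{1..p}" i n] sum.remove[of "{1..p}" i n'] by (simp add: n'_def)
  qed
  moreover have "(\<Sum>k=1..p. n' k) = n' t + (\<Sum>k\<in>{1..p} - {t}. n' k)"
    using t1 by (intro sum.remove) auto
  moreover have "e < n t" "n' t = n t \<or> t = i" using t1 by (auto simp: e_def n'_def)
  moreover have "degree ?P \<le> e + (\<Sum>k\<in>{1..p} - {t}. n' k)"
    using degree_mult_le[of "[:- \<xi> t, 1:] ^ e" R]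
    by (simp add: R_def degree_prod_linear_powers degree_linear_power)
  moreover have "t = i \<Longrightarrow> e < n i - 1"
    using t1 i(3) t by (metis Suc_pred' e_def i(2) leading_coeff_0_iff less_Suc_eq)
  \<comment> \<open>The strictness comes from \<open>e < n' t\<close>: for
    \<open>t \<noteq> i\<close> this is the degree bound on \<open>A t\<close>, for
    \<open>t = i\<close> it is the vanishing top coefficient.\<close>
  ultimately have "degree ?P < N" using i(2) by (cases "t = i") (auto simp: n'_def)
  then have 0: "functional A ?P = 0"
    using A unfolding A_solutions_iff by (auto simp: coeff_eq_0)
  have "coeff (A (fst s)) (snd s) * node_functional s ?P = 0" if s: "s \<in> slots p n - {(t, e)}" for s
  proof (cases "coeff (A (fst s)) (snd s) = 0")
    case False
    obtain k l where kl: "s = (k, l)" by force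
    then have kl1: "k \<in> {1..p}" "l < n k" using s by auto
    have "[:- \<xi> k, 1:] ^ Suc l dvd ?P"
    proof (cases "k = t")
      case True
      have "l \<le> e" using False kl True le_degree[of "A t" l] by (simp add: e_def)
      then have "Suc l \<le> e" using s kl True by auto
      then show ?thesis unfolding True by (intro dvd_mult2 le_imp_power_dvd)
    next
      case k: False
      \<comment> \<open>The one slot lost by reducing the power at \<open>i\<close>, namely
        \<open>(i, n i - 1)\<close>, has coefficient zero by hypothesis.\<close>
      have "Suc l \<le> n' k"
        using kl1 False kl i(3) by (cases "l = n i - 1") (auto simp: n'_def)
      then have "[:- \<xi> k, 1:] ^ Suc l dvd [:- \<xi> k, 1:] ^ n' k"
        by (rule le_imp_power_dvd)
      also have "\<dots> dvd R"
        unfolding R_def using k kl1 by (intro dvd_prodI) auto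
      finally show ?thesis by (rule dvd_mult)
    qed
    then show ?thesis
      using theta_zero[OF nodes[OF kl1(1)]] by (simp add: kl node_functional_def)
  qed simp
  then have "functional A ?P = coeff (A t) e * node_functional (t, e) ?P"
    unfolding functional_def using t1
    by (subst sum.remove[of _ "(t, e)"]) (auto simp: e_def sum.neutral)
  moreover have "coeff (A t) e \<noteq> 0" using t by (simp add: e_def)
  moreover have "poly R (\<xi> t) \<noteq> 0"
  proof
    assume "poly R (\<xi> t) = 0"
    then obtain k where k: "k \<in> {1..p} - {t}" "poly ([:- \<xi> k, 1:] ^ n' k) (\<xi> t) = 0"
      unfolding R_def poly_prod by (metis (no_types, lifting) finite_Diff finite_atLeastAtMost prod_zero_iff)
    then have "\<xi> k = \<xi> t" "n k > 0" by (auto simp: n'_def split: if_splits)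
    then have "k = t" using k t1 by (intro inj_onD[OF distinct_nodes]) auto
    then show False using k by simp
  qed
  then have "node_functional (t, e) ?P \<noteq> 0"
    using theta_nonzero[OF nodes[OF t1(1)]] G_pos[OF nodes[OF t1(1)]]
    by (simp add: node_functional_def less_imp_neq[symmetric] del: mult_pCons_left)
  ultimately show False using 0 by simp
qed

lemma poly_eq_sum_smult_monom:
  fixes P :: "real poly"
  assumes "\<And>r. r \<ge> N \<Longrightarrow> coeff P r = 0"
  shows "P = (\<Sum>r<N. smult (coeff P r) (monom 1 r))"
  using assms by (auto simp: poly_eq_iff smult_monom coeff_sum_monom)

lemma A_solution_exists:
  assumes n: "(\<Sum>i=1..p. n i) = N + 1"
  shows "\<exists>A\<in>A_solutions p q \<rho> d \<xi> n m. A \<noteq> 0"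
proof -
  \<comment> \<open>There are \<open>N\<close> linear equations for \<open>N + 1\<close> unknowns.
    The values of a node functional on the monomials are packed into the coefficients of
    \<open>f i\<close>, so that \<open>poly_family_dependent\<close> solves the system.\<close>
  define f where "f i = (\<Sum>r<N. monom (node_functional i (monom 1 r)) r)" for i
  have "\<exists>c. (\<exists>i\<in>slots p n. c i \<noteq> 0) \<and> (\<Sum>i\<in>slots p n. smult (c i) (f i)) = 0"
  proof (rule poly_family_dependent[where N = N])
    have "card (slots p n) = (\<Sum>i=1..p. n i)" by simp
    then show "card (slots p n) > N" using n by linarith
  qed (auto simp: f_def coeff_sum_monom)
  then obtain c where c: "\<exists>i\<in>slots p n. c i \<noteq> 0" "(\<Sum>i\<in>slots p n. smult (c i) (f i)) = 0" by blast
  define A where "A = coeff_vec p n c"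
  have Ac: "coeff (A (fst i)) (snd i) = c i" if "i \<in> slots p n" for i
    using that coeff_coeff_vec[of "fst i" "snd i" p n c] by (simp add: A_def)
  have "A \<noteq> 0" using c(1) Ac by force
  have "functional A (monom 1 r) = 0" if "r < N" for r
  proof -
    have "functional A (monom 1 r) = coeff (\<Sum>i\<in>slots p n. smult (c i) (f i)) r"
      using that unfolding functional_def coeff_sum
      by (intro sum.cong) (auto simp: Ac f_def coeff_sum_monom)
    then show ?thesis unfolding c(2) by simp
  qed
  then have "functional A P = 0" if "\<forall>r\<ge>N. coeff P r = 0" for P
    using poly_eq_sum_smult_monom[of P] that functional_sum[of A "coeff P" "monom 1" "{..<N}"] by simp
  then have "A \<in> A_solutions p q \<rho> d \<xi> n m"
    unfolding A_solutions_iff by (auto simp: A_def coeff_vec_in_poly_vectors)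
  then show ?thesis using \<open>A \<noteq> 0\<close> by blast
qed

lemma A_solutions_normal:
  assumes n: "(\<Sum>i=1..p. n i) = N + 1"
  shows "vector_space.dim scale_vec (A_solutions p q \<rho> d \<xi> n m) = 1"
    and "strongly_normal p n (A_solutions p q \<rho> d \<xi> n m)"
proof -
  let ?V = "A_solutions p q \<rho> d \<xi> n m"
  obtain A0 where A0: "A0 \<in> ?V" "A0 \<noteq> 0" using A_solution_exists[OF n] by blast
  obtain i where i: "i \<in> {1..p}" "n i > 0"
    using n by (metis Suc_eq_plus1 gr0I nat.distinct(1) sum.neutral)
  have top: "coeff (A k) (n k - 1) \<noteq> 0" if "A \<in> ?V" "A \<noteq> 0" "k \<in> {1..p}" "n k > 0" for A k
    using A_solution_eq_0[OF that(1) n that(3,4)] that(2) by blast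
  have V: "?V = range (\<lambda>c. scale_vec c A0)"
  proof (intro equalityI subsetI)
    fix A assume A: "A \<in> ?V"
    \<comment> \<open>Chosen to cancel the top coefficient of component \<open>i\<close>, which by
      \<open>A_solution_eq_0\<close> makes the difference vanish altogether.\<close>
    define c where "c = coeff (A i) (n i - 1) / coeff (A0 i) (n i - 1)"
    have "A - scale_vec c A0 \<in> ?V"
      using A A0(1) unfolding A_solutions_iff by (auto simp: poly_vectors_lincomb functional_diff_scale)
    moreover have "coeff ((A - scale_vec c A0) i) (n i - 1) = 0"
      using top[OF A0 i] by (simp add: scale_vec_def c_def)
    ultimately have "A - scale_vec c A0 = 0"
      by (intro A_solution_eq_0[OF _ n i])
    then have "A = scale_vec c A0" by simp
    then show "A \<in> range (\<lambda>c. scale_vec c A0)" by blast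
  next
    fix A assume "A \<in> range (\<lambda>c. scale_vec c A0)"
    then show "A \<in> ?V"
      using A0(1) unfolding A_solutions_iff by (auto simp: poly_vectors_scale functional_scale)
  qed
  show "vector_space.dim scale_vec ?V = 1"
    by (rule weakly_normal_line(2)[OF A0(2) V])
  have "A k \<noteq> 0 \<and> degree (A k) = n k - 1" if A: "A \<in> ?V" "A \<noteq> 0" "k \<in> {1..p}" "n k > 0" for A k
  proof -
    have "A k \<noteq> 0" "n k - 1 \<le> degree (A k)" using top[OF A] by (auto intro: le_degree)
    moreover have "degree (A k) < n k"
      using A \<open>A k \<noteq> 0\<close> by (auto simp: A_solutions_def poly_vectors_def)
    ultimately show ?thesis by simp
  qed
  then show "strongly_normal p n ?V"
    unfolding strongly_normal_def using weakly_normal_line(1)[OF A0(2) V] by blast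
qed

section \<open>The B-problem and the decomposition of \<open>B_LII\<close>\<close>

definition node_poly :: "real poly" where
  "node_poly = (\<Prod>i=1..p. [:- \<xi> i, 1:] ^ n i)"

lemma B_solutions_iff:
  "B \<in> B_solutions p q \<rho> d \<xi> n m \<longleftrightarrow> B \<in> poly_vectors q m \<and> node_poly dvd vec_symbol B"
proof (cases "B \<in> poly_vectors q m")
  case B: True
  have "vanishing_integral (\<lambda>y. y ^ k * exp (- \<xi> i * y) * B_form q \<rho> d B y) \<longleftrightarrow>
      poly (theta m k (vec_symbol B)) (\<xi> i) = 0" if i: "i \<in> {1..p}" for i k
  proof -
    have "has_bochner_integral lborel (\<lambda>y. indicator {0<..} y * (y ^ k * exp (- \<xi> i * y) * B_form q \<rho> d B y))
        (poly (theta m k (vec_symbol B)) (\<xi> i) * G (\<lambda>h. m h + k) (\<xi> i))"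
      using represents_B_form[OF B] nodes[OF i] unfolding represents_def by blast
    from vanishing_integral_iff[OF this] show ?thesis
      using G_pos[OF nodes[OF i], of "\<lambda>h. m h + k"] by simp
  qed
  then have "B \<in> B_solutions p q \<rho> d \<xi> n m \<longleftrightarrow>
      (\<forall>i\<in>{1..p}. \<forall>k<n i. poly (theta m k (vec_symbol B)) (\<xi> i) = 0)"
    using B by (auto simp: B_solutions_def)
  also have "\<dots> \<longleftrightarrow> (\<forall>i\<in>{1..p}. [:- \<xi> i, 1:] ^ n i dvd vec_symbol B)"
    using theta_zero_iff_dvd[OF nodes] by blast
  also have "\<dots> \<longleftrightarrow> node_poly dvd vec_symbol B"
  proof
    assume "\<forall>i\<in>{1..p}. [:- \<xi> i, 1:] ^ n i dvd vec_symbol B"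
    then show "node_poly dvd vec_symbol B"
      unfolding node_poly_def by (intro prod_linear_powers_dvd distinct_nodes) auto
  next
    assume "node_poly dvd vec_symbol B"
    moreover have "[:- \<xi> i, 1:] ^ n i dvd node_poly" if "i \<in> {1..p}" for i
      unfolding node_poly_def using that by (intro dvd_prodI) auto
    ultimately show "\<forall>i\<in>{1..p}. [:- \<xi> i, 1:] ^ n i dvd vec_symbol B"
      using dvd_trans by blast
  qed
  finally show ?thesis using B by simp
qed (simp add: B_solutions_def)

text \<open>The symbol of a solution is a multiple of \<open>node_poly\<close>, of degree less than
  \<open>N = degree node_poly + 1\<close>, so the cofactor is constant; \<open>vec_symbol\<close> is
  a bijection onto the polynomials in question.\<close>

lemma B_solutions_line:
  assumes n: "(\<Sum>i=1..p. n i) = N - 1" and N: "N \<ge> 1"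
  shows "\<exists>B0. B0 \<noteq> 0 \<and> B_solutions p q \<rho> d \<xi> n m = range (\<lambda>c. scale_vec c B0)"
proof -
  have deg: "degree node_poly = N - 1"
    unfolding node_poly_def degree_prod_linear_powers by (rule n)
  have nz: "node_poly \<noteq> 0" by (auto simp: node_poly_def)
  obtain B0 where B0: "B0 \<in> poly_vectors q m" "vec_symbol B0 = node_poly"
    using vec_symbol_surj[of node_poly] deg N by (auto simp: coeff_eq_0)
  have "B0 \<noteq> 0" using B0 nz by (auto simp: vec_symbol_eq)
  have scale: "vec_symbol (scale_vec c B0) = smult c node_poly" for c
    by (simp add: vec_symbol_eq scale_vec_def flip: B0(2) smult_sum_right smult_smult)
  have "B_solutions p q \<rho> d \<xi> n m = range (\<lambda>c. scale_vec c B0)"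
  proof (intro equalityI subsetI)
    fix B assume "B \<in> B_solutions p q \<rho> d \<xi> n m"
    then have B: "B \<in> poly_vectors q m" "node_poly dvd vec_symbol B"
      unfolding B_solutions_iff by auto
    then obtain C where C: "vec_symbol B = node_poly * C" by (elim dvdE)
    have "degree C = 0"
    proof (cases "C = 0")
      case False
      then have "vec_symbol B \<noteq> 0" using C nz by simp
      then have "degree (vec_symbol B) < N"
        using N by (intro degree_lessI) (auto simp: vec_symbol_coeff)
      then show ?thesis using C False nz deg by (simp add: degree_mult_eq)
    qed simp
    then obtain c where "C = [:c:]" by (elim degree_eq_zeroE)
    then have "vec_symbol B = vec_symbol (scale_vec c B0)" using C by (simp add: scale)
    then have "B = scale_vec c B0"
      by (intro vec_symbol_inj B(1) poly_vectors_scale B0(1))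
    then show "B \<in> range (\<lambda>c. scale_vec c B0)" by blast
  next
    fix B assume "B \<in> range (\<lambda>c. scale_vec c B0)"
    then show "B \<in> B_solutions p q \<rho> d \<xi> n m"
      unfolding B_solutions_iff using B0(1) by (auto simp: poly_vectors_scale scale dvd_smult)
  qed
  then show ?thesis using \<open>B0 \<noteq> 0\<close> by blast
qed

lemma B_LII_decomposition:
  assumes n: "(\<Sum>i=1..p. n i) = N - 1" and N: "N \<ge> 1"
  shows "\<exists>!B. B \<in> poly_vectors q m \<and> (\<forall>y>0. B_LII p q \<rho> d \<xi> n m y = B_form q \<rho> d B y)"
proof -
  \<comment> \<open>The polynomial of the operator in \<open>B_LII\<close>, sign included:
    \<open>[:\<xi> i, -1:]\<close> stands for \<open>\<xi> i - d/dy\<close>. Its degree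
    \<open>N - 1\<close> puts it in the range of \<open>vec_symbol\<close>.\<close>
  define P where "P = smult (-1) (\<Prod>i=1..p. [:\<xi> i, -1:] ^ n i)"
  have list: "(\<Sum>i\<leftarrow>[1..<Suc p]. f i) = (\<Sum>i=1..p. f i)" "(\<Prod>i\<leftarrow>[1..<Suc p]. g i) = (\<Prod>i=1..p. g i)"
    for f :: "nat \<Rightarrow> nat" and g :: "nat \<Rightarrow> real poly"
    unfolding atLeastLessThanSuc_atLeastAtMost[symmetric]
    by (simp_all only: sum.distinct_set_conv_list[symmetric] prod.distinct_set_conv_list[symmetric]
        distinct_upt set_upt)
  have "degree (\<Prod>i=1..p. [:\<xi> i, -1:] ^ n i) = N - 1"
    by (subst degree_prod_eq_sum_degree) (auto simp: n[simplified])
  then obtain B where B: "B \<in> poly_vectors q m" "vec_symbol B = P"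
    using vec_symbol_surj[of P] N by (auto simp: P_def coeff_eq_0)
  have "B_LII p q \<rho> d \<xi> n m y = B_form q \<rho> d B y" if y: "y > 0" for y
  proof -
    have "foldr (\<lambda>i. shift_op (\<xi> i) ^^ n i) [1..<Suc p] (T m) y =
        diff_op m (\<Prod>i\<leftarrow>[1..<Suc p]. [:\<xi> i, -1:] ^ n i) y"
      using n N y by (intro foldr_shift_op_diff_op) (simp_all only: list N_def)
    then have "B_LII p q \<rho> d \<xi> n m y = diff_op m P y"
      unfolding B_LII_def S_fun_eq_T P_def diff_op_smult list by simp
    also have "\<dots> = B_form q \<rho> d B y"
      using represents_B_form[OF B(1)] y unfolding represents_def B(2) by simp
    finally show ?thesis .
  qed
  then show ?thesis
    using B(1) by (intro ex1I[of _ B]) (auto intro!: B_form_inj)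
qed

end

theorem corollary4p6:
  fixes p q N :: nat and d \<rho> \<xi> :: "nat \<Rightarrow> real" and m :: "nat \<Rightarrow> nat"
  assumes "p \<ge> 1" and "q \<ge> 1"
    and "\<And>h. h \<in> {1..q} \<Longrightarrow> d h > 0 \<and> \<rho> h > 0"
    and "\<And>i h. i \<in> {1..p} \<Longrightarrow> h \<in> {1..q} \<Longrightarrow> \<xi> i + \<rho> h > 0"
    and "\<And>i j. i \<in> {1..q} \<Longrightarrow> j \<in> {1..q} \<Longrightarrow> \<bar>int (m i) - int (m j)\<bar> \<le> 1"
    and "N = (\<Sum>j=1..q. m j)" and "N \<ge> 1"
    and "inj_on \<rho> {h \<in> {1..q}. m h > 0}"
  shows
    "(\<forall>n :: nat \<Rightarrow> nat.
        (\<Sum>i=1..p. n i) = N + 1 \<and> inj_on \<xi> {i \<in> {1..p}. n i > 0} \<longrightarrow>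
          vector_space.dim scale_vec (A_solutions p q \<rho> d \<xi> n m) = 1 \<and>
          strongly_normal p n (A_solutions p q \<rho> d \<xi> n m)) \<and>
     (\<forall>n :: nat \<Rightarrow> nat.
        (\<Sum>i=1..p. n i) = N - 1 \<and> inj_on \<xi> {i \<in> {1..p}. n i > 0} \<longrightarrow>
          vector_space.dim scale_vec (B_solutions p q \<rho> d \<xi> n m) = 1 \<and>
          weakly_normal (B_solutions p q \<rho> d \<xi> n m) \<and>
          (\<forall>B \<in> B_solutions p q \<rho> d \<xi> n m. B \<noteq> 0 \<longrightarrow> (\<exists>y>0. B_form q \<rho> d B y \<noteq> 0)) \<and>
          (\<exists>!B. B \<in> poly_vectors q m \<and>
                (\<forall>y>0. B_LII p q \<rho> d \<xi> n m y = B_form q \<rho> d B y))) \<and>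
     (inj_on \<rho> {1..q} \<longrightarrow> lin_indep_over_polys q (F_fun q \<rho> d))"
proof -
  interpret gamma_system q d \<rho>
    using assms(2,3) by unfold_locales auto
  interpret near_diagonal q d \<rho> m
  proof
    show "m i \<le> Suc (m j)" if "i \<in> {1..q}" "j \<in> {1..q}" for i j
      using assms(5)[OF that] by linarith
  qed (rule assms(8))
  have N: "N = local.N" using assms(6) by (simp add: N_def)
  have column: "column_nodes q d \<rho> m p \<xi> n" if "inj_on \<xi> {i \<in> {1..p}. n i > 0}" for n
    using that assms(4) by unfold_locales (auto simp: region_def)
  show ?thesis
  proof (intro conjI allI impI)
    fix n assume *: "(\<Sum>i=1..p. n i) = N + 1 \<and> inj_on \<xi> {i \<in> {1..p}. n i > 0}"
    interpret column_nodes q d \<rho> m p \<xi> n using * by (intro column) simp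
    show "vector_space.dim scale_vec (A_solutions p q \<rho> d \<xi> n m) = 1"
        "strongly_normal p n (A_solutions p q \<rho> d \<xi> n m)"
      using A_solutions_normal * unfolding N by blast+
  next
    fix n assume *: "(\<Sum>i=1..p. n i) = N - 1 \<and> inj_on \<xi> {i \<in> {1..p}. n i > 0}"
    interpret column_nodes q d \<rho> m p \<xi> n using * by (intro column) simp
    have n: "(\<Sum>i=1..p. n i) = local.N - 1" "local.N \<ge> 1"
      using * assms(7) unfolding N by auto
    obtain B0 where B0: "B0 \<noteq> 0" "B_solutions p q \<rho> d \<xi> n m = range (\<lambda>c. scale_vec c B0)"
      using B_solutions_line[OF n] by blast
    have "\<exists>y>0. B_form q \<rho> d B y \<noteq> 0" if "B \<in> B_solutions p q \<rho> d \<xi> n m" "B \<noteq> 0" for B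
      using B_form_nonzero[of B] that unfolding B_solutions_iff by blast
    then show "vector_space.dim scale_vec (B_solutions p q \<rho> d \<xi> n m) = 1"
        "weakly_normal (B_solutions p q \<rho> d \<xi> n m)"
        "\<forall>B \<in> B_solutions p q \<rho> d \<xi> n m. B \<noteq> 0 \<longrightarrow> (\<exists>y>0. B_form q \<rho> d B y \<noteq> 0)"
        "\<exists>!B. B \<in> poly_vectors q m \<and> (\<forall>y>0. B_LII p q \<rho> d \<xi> n m y = B_form q \<rho> d B y)"
      using weakly_normal_line[OF B0] B_LII_decomposition[OF n] by blast+
  next
    assume inj: "inj_on \<rho> {1..q}"
    show "lin_indep_over_polys q (F_fun q \<rho> d)"
      unfolding lin_indep_over_polys_def
    proof (intro allI impI ballI)
      fix P :: "nat \<Rightarrow> real poly" and j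
      assume P: "\<forall>y>0. (\<Sum>j=1..q. poly (P j) y * F_fun q \<rho> d j y) = 0" and j: "j \<in> {1..q}"
      \<comment> \<open>The constant index \<open>K\<close> is near the diagonal and exceeds all
        degrees. It is positive, so the condition on the rates concerns every
        \<open>\<rho> h\<close>; \<open>B_form_nonzero\<close> then applies with \<open>K\<close> in
        place of \<open>m\<close>.\<close>
      define K where "K = Suc (\<Sum>j=1..q. degree (P j))"
      define B where "B j = (if j \<in> {1..q} then P j else 0)" for j
      interpret wide: near_diagonal q d \<rho> "\<lambda>_. K"
        using inj by unfold_locales (auto intro: inj_on_subset)
      have "degree (P j) < K" if "j \<in> {1..q}" for j
        unfolding K_def less_Suc_eq_le using that by (intro member_le_sum) auto
      then have "B \<in> poly_vectors q (\<lambda>_. K)"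
        by (auto simp: poly_vectors_def B_def)
      moreover have "B_form q \<rho> d B y = (\<Sum>j=1..q. poly (P j) y * F_fun q \<rho> d j y)" for y
        unfolding B_form_def by (intro sum.cong) (auto simp: B_def)
      ultimately have "B = 0"
        using P by (intro wide.B_form_nonzero) auto
      then have "B j = 0" by simp
      then show "P j = 0" using j by (simp add: B_def)
    qed
  qed
qed

end
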